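(* Let $K$ be a finite simplicial complex and let $\{K^{*(m)}\}_{m\in\mathbb{N}_0}$ be its sequence of iterated Alexander duals. Then: (i) there exist $m\in\mathbb{N}_0$ and $d$ such that $K^{*(m)}=\partial\Delta^d$ if and only if $K$ is a minimal $NH$-sphere; (ii) there exist $m\in\mathbb{N}_0$ and $d$ such that $K^{*(m)}=\Delta^d$ if and only if $K$ is a minimal $NH$-ball.
   Context: All simplicial complexes are finite. For a finite vertex set $V$, $\Delta(V)$ is the simplex spanned by $V$; $\Delta^d$ denotes a $d$-simplex and $\partial\Delta^d$ its boundary complex. $\{\emptyset\}$ is the complex containing only the empty simplex; $\partial\Delta^0=\{\emptyset\}$, regarded as a sphere of dimension $-1$; $\emptyset$ denotes the void complex. $V_K$ is the vertex set of $K$ and $\Delta_K=\Delta(V_K)$. A simplex is principal (maximal) in $K$ if it is not a proper face of another simplex of $K$; $\mathsf{m}(K)$ is the number of principal simplices. A subcomplex $L\subset K$ is top generated if every principal simplex of $L$ is principal in $K$. $K+L$ denotes union; $lk(\sigma,K)=\{\tau\in K:\tau\cap\sigma=\emptyset,\ \tau*\sigma\in K\}$. A combinatorial $d$-ball (resp. $d$-sphere) is a complex having a common subdivision with $\Delta^d$ (resp. $\partial\Delta^{d+1}$); the boundary $\partial L$ of a combinatorial $d$-ball $L$ is the subcomplex generated by the $(d-1)$-simplices that are faces of exactly one $d$-simplex. A complex is collapsible if some subdivision of it simplicially collapses to a vertex. $NH$-manifolds, balls, spheres: in dimension $0$ these are the $0$-dimensional manifolds, balls (a point), spheres (two points); the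 $NH$-sphere of dimension $-1$ is $\{\emptyset\}$. For $d\ge1$, inductively: an $NH$-manifold of dimension $d$ is a $d$-dimensional complex $M$ such that for every vertex $v$, $lk(v,M)$ is an $NH$-ball of dimension $k$ with $0\le k\le d-1$ or an $NH$-sphere of dimension $k$ with $-1\le k\le d-1$; an $NH$-ball of dimension $d$ is a collapsible $NH$-manifold of dimension $d$; an $NH$-sphere of dimension $d$ and homotopy dimension $k$ is an $NH$-manifold $S$ of dimension $d$ for which there exist a top generated $NH$-ball $B$ of dimension $d$ and a top generated combinatorial $k$-ball $L$ with $B+L=S$ and $B\cap L=\partial L$; $S=B+L$ is called a decomposition and $\dim_h(S)=k$. A minimal $NH$-sphere is an $NH$-sphere $S$ with $\mathsf{m}(S)=\dim_h(S)+2$. A minimal $NH$-ball is an $NH$-ball $B$ for which there is a minimal $NH$-sphere $S$ admitting a decomposition $S=B+L$. Alexander dual: for $V\supseteq V_K$, $K^{*_V}=\{\sigma\in\Delta(V):\Delta(V-V_\sigma)\notin K\}$, and $K^*:=K^{*_{V_K}}$. Iterated duals: $K^{*(0)}=K$, $K^{*(m)}=(K^{*(m-1)})^*$ (each dual taken relative to the vertices of the complex being dualized).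
   Formalization: The sequence of iterated duals is taken to stay void once it reaches the void complex; read literally, the dual of the void complex is {∅} = ∂Δ^0, so every simplex Δ^d would reach ∂Δ^0 at m = 2 and (i) would fail. *)

theory Defs
  imports Complex_Main "HOL-Library.Infinite_Typeclass"
begin

section \<open>Finite simplicial complexes\<close>

text \<open>A complex is given by the vertex sets of its simplices, the empty simplex included.
  Thus \<open>{{}}\<close> is the complex containing only the empty simplex and \<open>{}\<close> is the void complex.\<close>

definition fin_complex :: "'a set set \<Rightarrow> bool" where
  "fin_complex K \<longleftrightarrow>
     finite K \<and> (\<forall>\<sigma>\<in>K. finite \<sigma>) \<and> (\<forall>\<sigma>\<in>K. \<forall>\<tau>. \<tau> \<subseteq> \<sigma> \<longrightarrow> \<tau> \<in> K)"

definition verts :: "'a set set \<Rightarrow> 'a set" where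
  "verts K = \<Union>K"

definition has_dim :: "'a set set \<Rightarrow> nat \<Rightarrow> bool" where
  "has_dim K d \<longleftrightarrow> (\<exists>\<sigma>\<in>K. card \<sigma> = Suc d) \<and> (\<forall>\<sigma>\<in>K. card \<sigma> \<le> Suc d)"

definition principal :: "'a set set \<Rightarrow> 'a set set" where
  "principal K = {\<sigma> \<in> K. \<forall>\<tau>\<in>K. \<not> \<sigma> \<subset> \<tau>}"

definition num_principal :: "'a set set \<Rightarrow> nat" where
  "num_principal K = card (principal K)"

definition top_generated :: "'a set set \<Rightarrow> 'a set set \<Rightarrow> bool" where
  "top_generated L K \<longleftrightarrow> fin_complex L \<and> L \<subseteq> K \<and> principal L \<subseteq> principal K"

definition link :: "'a set \<Rightarrow> 'a set set \<Rightarrow> 'a set set" where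
  "link \<sigma> K = {\<tau> \<in> K. \<tau> \<inter> \<sigma> = {} \<and> \<tau> \<union> \<sigma> \<in> K}"

definition is_simplex :: "nat \<Rightarrow> 'a set set \<Rightarrow> bool" where
  "is_simplex d K \<longleftrightarrow> (\<exists>V. finite V \<and> card V = Suc d \<and> K = Pow V)"

definition is_simplex_boundary :: "nat \<Rightarrow> 'a set set \<Rightarrow> bool" where
  "is_simplex_boundary d K \<longleftrightarrow> (\<exists>V. finite V \<and> card V = Suc d \<and> K = Pow V - {V})"

section \<open>Subdivisions\<close>

text \<open>Points of the geometric realization are written in barycentric coordinates.\<close>

definition geom_simplex :: "'a set \<Rightarrow> ('a \<Rightarrow> real) set" where
  "geom_simplex \<sigma> = {x. (\<forall>v. 0 \<le> x v) \<and> (\<forall>v. v \<notin> \<sigma> \<longrightarrow> x v = 0) \<and> (\<Sum>v\<in>\<sigma>. x v) = 1}"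

definition realization :: "'a set set \<Rightarrow> ('a \<Rightarrow> real) set" where
  "realization K = (\<Union>\<sigma>\<in>K. geom_simplex \<sigma>)"

text \<open>The extension of a placement \<open>p\<close> of the vertices of \<open>J\<close>, affine on each simplex.\<close>

definition affine_ext :: "'b set set \<Rightarrow> ('b \<Rightarrow> 'a \<Rightarrow> real) \<Rightarrow> ('b \<Rightarrow> real) \<Rightarrow> 'a \<Rightarrow> real" where
  "affine_ext J p x = (\<lambda>a. \<Sum>v\<in>verts J. x v * p v a)"

text \<open>\<open>J\<close> is, up to relabelling its vertices, a subdivision of \<open>K\<close>: the vertices of \<open>J\<close> can be
  placed in the realization of \<open>K\<close> so that every simplex of \<open>J\<close> lies in a simplex of \<open>K\<close> and the
  realization of \<open>J\<close> is identified with that of \<open>K\<close>. The first equivalence only serves to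
  distinguish \<open>{}\<close> from \<open>{{}}\<close>, both of which have empty realization.\<close>

definition subdivides :: "'b set set \<Rightarrow> 'a set set \<Rightarrow> bool" where
  "subdivides J K \<longleftrightarrow> fin_complex J \<and> fin_complex K \<and> (J = {} \<longleftrightarrow> K = {}) \<and>
     (\<exists>p. (\<forall>\<sigma>\<in>J. \<exists>\<tau>\<in>K. p ` \<sigma> \<subseteq> geom_simplex \<tau>) \<and>
          bij_betw (affine_ext J p) (realization J) (realization K))"

text \<open>Since complexes are finite, subdivisions may be taken with natural numbers as vertices.\<close>

definition combinatorial_ball :: "nat \<Rightarrow> 'a set set \<Rightarrow> bool" where
  "combinatorial_ball d L \<longleftrightarrow>
     (\<exists>J :: nat set set. subdivides J L \<and> subdivides J (Pow {0..d}))"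

text \<open>The boundary of a combinatorial \<open>d\<close>-ball \<open>L\<close>.\<close>

definition ball_boundary :: "nat \<Rightarrow> 'a set set \<Rightarrow> 'a set set" where
  "ball_boundary d L =
     {\<tau>. \<exists>\<rho>\<in>L. \<tau> \<subseteq> \<rho> \<and> card \<rho> = d \<and> (\<exists>!\<sigma>. \<sigma> \<in> L \<and> card \<sigma> = Suc d \<and> \<rho> \<subseteq> \<sigma>)}"

definition elem_collapse :: "'a set set \<Rightarrow> 'a set set \<Rightarrow> bool" where
  "elem_collapse K K' \<longleftrightarrow>
     (\<exists>\<tau> \<sigma>. \<tau> \<in> K \<and> \<sigma> \<in> K \<and> \<tau> \<noteq> {} \<and> \<tau> \<subset> \<sigma> \<and> (\<forall>\<rho>\<in>K. \<tau> \<subset> \<rho> \<longrightarrow> \<rho> = \<sigma>) \<and>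
            K' = K - {\<tau>, \<sigma>})"

definition collapsible :: "'a set set \<Rightarrow> bool" where
  "collapsible K \<longleftrightarrow>
     (\<exists>(J :: nat set set) v. subdivides J K \<and> elem_collapse\<^sup>*\<^sup>* J {{}, {v}})"

section \<open>NH-manifolds, NH-balls and NH-spheres\<close>

text \<open>\<open>nh_sphere d k S\<close>: \<open>S\<close> is an NH-sphere of dimension \<open>d\<close> and homotopy dimension \<open>k\<close>.
  The only sphere of negative dimension is \<open>{{}}\<close>, with \<open>d = k = -1\<close>.\<close>

inductive nh_manifold :: "nat \<Rightarrow> 'a set set \<Rightarrow> bool"
  and nh_ball :: "nat \<Rightarrow> 'a set set \<Rightarrow> bool"
  and nh_sphere :: "int \<Rightarrow> int \<Rightarrow> 'a set set \<Rightarrow> bool"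
where
  manifold_0: "\<lbrakk>fin_complex M; has_dim M 0\<rbrakk> \<Longrightarrow> nh_manifold 0 M"
| ball_0: "nh_ball 0 {{}, {v}}"
| sphere_minus_1: "nh_sphere (- 1) (- 1) {{}}"
| sphere_0: "v \<noteq> w \<Longrightarrow> nh_sphere 0 0 {{}, {v}, {w}}"
| manifold:
    "\<lbrakk>1 \<le> d; fin_complex M; has_dim M d;
      \<forall>v\<in>verts M.
        (\<exists>k. k \<le> d - 1 \<and> nh_ball k (link {v} M)) \<or>
        (\<exists>k h. - 1 \<le> k \<and> k \<le> int d - 1 \<and> nh_sphere k h (link {v} M))\<rbrakk>
     \<Longrightarrow> nh_manifold d M"
| ball: "\<lbrakk>1 \<le> d; nh_manifold d B; collapsible B\<rbrakk> \<Longrightarrow> nh_ball d B"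
| sphere:
    "\<lbrakk>1 \<le> d; nh_manifold d S;
      nh_ball d B; top_generated B S;
      combinatorial_ball k L; top_generated L S;
      B \<union> L = S; B \<inter> L = ball_boundary k L\<rbrakk>
     \<Longrightarrow> nh_sphere (int d) (int k) S"

definition nh_decomposition :: "nat \<Rightarrow> nat \<Rightarrow> 'a set set \<Rightarrow> 'a set set \<Rightarrow> 'a set set \<Rightarrow> bool" where
  "nh_decomposition d k S B L \<longleftrightarrow>
     nh_ball d B \<and> top_generated B S \<and> combinatorial_ball k L \<and> top_generated L S \<and>
     B \<union> L = S \<and> B \<inter> L = ball_boundary k L"

definition minimal_nh_sphere :: "'a set set \<Rightarrow> bool" where
  "minimal_nh_sphere S \<longleftrightarrow> (\<exists>d k. nh_sphere d k S \<and> int (num_principal S) = k + 2)"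

text \<open>The sphere \<open>S\<close> may need vertices outside \<open>B\<close>, so the vertices must come from an infinite
  type: over a finite type a ball could use up all available vertices.\<close>

definition minimal_nh_ball :: "'a::infinite set set \<Rightarrow> bool" where
  "minimal_nh_ball B \<longleftrightarrow>
     (\<exists>S L d k. nh_sphere (int d) (int k) S \<and> int (num_principal S) = int k + 2 \<and>
                nh_decomposition d k S B L)"

section \<open>Alexander duals\<close>

definition alexander_dual_on :: "'a set \<Rightarrow> 'a set set \<Rightarrow> 'a set set" where
  "alexander_dual_on V K = {\<sigma>. \<sigma> \<subseteq> V \<and> V - \<sigma> \<notin> K}"

definition alexander_dual :: "'a set set \<Rightarrow> 'a set set" where
  "alexander_dual K = alexander_dual_on (verts K) K"

text \<open>The sequence of iterated duals is not continued beyond the void complex: once void, it stays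
  void. Dualizing the void complex relative to its (empty) vertex set would give \<open>{{}}\<close>, the
  boundary of a 0-simplex; as the dual of a simplex is void, the iterated duals of every simplex
  would then reach the boundary of a simplex, although a simplex is not an NH-sphere.\<close>

fun iterated_dual :: "nat \<Rightarrow> 'a set set \<Rightarrow> 'a set set" where
  "iterated_dual 0 K = K"
| "iterated_dual (Suc m) K =
     (if iterated_dual m K = {} then {} else alexander_dual (iterated_dual m K))"

lemma alexander_dual_void: "alexander_dual {} = {{}}"
  by (auto simp: alexander_dual_def alexander_dual_on_def verts_def)

lemma alexander_dual_simplex: "alexander_dual (Pow V) = {}"
  by (auto simp: alexander_dual_def alexander_dual_on_def verts_def)

lemma iterated_dual_eq_funpow:
  assumes "\<forall>j<m. (alexander_dual ^^ j) K \<noteq> {}"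
  shows "iterated_dual m K = (alexander_dual ^^ m) K"
  using assms by (induction m) auto

end

theory Submission
  imports Defs "HOL-Homology.Brouwer_Degree"
begin

text \<open>
  Both sides of each equivalence describe the same explicit complexes. Take a finite set \<open>F\<close> and a
  chain of nonempty finite sets \<open>X v\<close> (\<open>v \<in> F\<close>) disjoint from \<open>F\<close>. The sets \<open>F - {v} \<union> X v\<close> are the
  facets of a ball, and together with \<open>F\<close> they are the facets of a sphere.

  The double dual of \<open>K\<close> is the link of the set of vertices \<open>v\<close> for which all vertices but \<open>v\<close> span a
  simplex. On these complexes it deletes from \<open>F\<close> the vertices with the largest \<open>X v\<close>, and
  conversely it can be undone by adding such vertices to \<open>F\<close>.

  Links of vertices in these complexes are again of this form, and a ball of this form is a cone, with
  any common point of the sets \<open>X v\<close> as apex. Hence they are NH-balls and NH-spheres. Conversely, let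
  \<open>B + L\<close> be a minimal NH-sphere. A \<open>k\<close>-simplex \<open>F\<close> of \<open>L\<close> and the facets adjacent to it along its
  ridges already are \<open>k + 2\<close> facets, which gives the shape of the facets. Two sets \<open>X u\<close>, \<open>X v\<close> that
  meet are comparable because the intersection of the corresponding facets has as its link two
  disjoint simplices, which is an NH-ball or NH-sphere only if one of them is a point. All of them meet
  since otherwise \<open>B\<close> would retract onto the boundary of \<open>F\<close>, although it is contractible.
\<close>

section \<open>Complexes generated by chains\<close>

text \<open>Duality is an involution only relative to a fixed vertex set. The dual loses the
  vertices in \<open>codim_one_verts K\<close>, and this loss is what turns the double dual into a
  link. Passing back through the sequence two steps at a time leaves two base cases:
  \<open>K\<close> or its dual is a simplex or the boundary of one. The description by
  \<open>F\<close> and \<open>X\<close> is not unique. A simplex on \<open>V\<close> is the ball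
  over \<open>{w}\<close> with exchange set \<open>V\<close> for any \<open>w\<close> outside
  \<open>V\<close>; such a \<open>w\<close> is not a vertex, so it has to be chosen afresh at times.
  Combinatorial balls are known only up to subdivision. All that is extracted from \<open>L\<close>
  is its dimension, which linear algebra shows to be invariant; it supplies the simplex
  \<open>F\<close>. The contractibility of \<open>B\<close> is where the noncontractibility of
  spheres enters. In a decomposition \<open>L\<close> may have several facets, so \<open>B\<close>
  need not be the ball over the same \<open>F\<close>; the indices of the missing facets are then
  absorbed into the exchange sets.\<close>

lemma fin_complexD:
  assumes "fin_complex K"
  shows "finite K" "\<sigma> \<in> K \<Longrightarrow> finite \<sigma>" "\<sigma> \<in> K \<Longrightarrow> \<tau> \<subseteq> \<sigma> \<Longrightarrow> \<tau> \<in> K" "finite (verts K)"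
  using assms unfolding fin_complex_def verts_def by blast+

lemma fin_complex_Pow: "finite A \<Longrightarrow> fin_complex (Pow A)"
  by (auto simp: fin_complex_def intro: finite_subset)

lemma fin_complex_Un: "fin_complex A \<Longrightarrow> fin_complex B \<Longrightarrow> fin_complex (A \<union> B)"
  unfolding fin_complex_def by (metis Un_iff finite_UnI)

lemma fin_complex_UN: "finite I \<Longrightarrow> (\<And>i. i \<in> I \<Longrightarrow> fin_complex (A i)) \<Longrightarrow> fin_complex (\<Union>i\<in>I. A i)"
  unfolding fin_complex_def by (metis (no_types, lifting) UN_iff finite_UN_I)

lemma in_verts_iff: "fin_complex K \<Longrightarrow> v \<in> verts K \<longleftrightarrow> {v} \<in> K"
  unfolding fin_complex_def verts_def by (metis Union_iff empty_subsetI insert_subset singletonI)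

lemma ex_principal_superset:
  assumes "fin_complex K" "\<sigma> \<in> K"
  shows "\<exists>F\<in>principal K. \<sigma> \<subseteq> F"
proof -
  obtain F where "F \<in> K" "\<sigma> \<subseteq> F" "\<forall>G\<in>K. F \<subseteq> G \<longrightarrow> F = G"
    using finite_has_maximal2[OF fin_complexD(1)[OF assms(1)] assms(2)] by blast
  then have "F \<in> principal K"
    unfolding principal_def by auto
  then show ?thesis
    using \<open>\<sigma> \<subseteq> F\<close> by (rule rev_bexI)
qed

lemma Union_Pow_principal:
  assumes "fin_complex K"
  shows "K = (\<Union>F\<in>principal K. Pow F)"
proof (intro equalityI subsetI)
  fix \<sigma> assume "\<sigma> \<in> K"
  then show "\<sigma> \<in> (\<Union>F\<in>principal K. Pow F)"
    using ex_principal_superset[OF assms] by simp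
next
  fix \<sigma> assume "\<sigma> \<in> (\<Union>F\<in>principal K. Pow F)"
  then obtain F where "F \<in> principal K" "\<sigma> \<subseteq> F"
    by auto
  then show "\<sigma> \<in> K"
    using fin_complexD(3)[OF assms, of F \<sigma>] by (simp add: principal_def)
qed

lemma principal_Union_Pow:
  assumes "\<And>A B. A \<in> \<F> \<Longrightarrow> B \<in> \<F> \<Longrightarrow> A \<subseteq> B \<Longrightarrow> A = B"
  shows "principal (\<Union>A\<in>\<F>. Pow A) = \<F>"
proof (intro equalityI subsetI)
  fix A assume "A \<in> principal (\<Union>A\<in>\<F>. Pow A)"
  then obtain B where "B \<in> \<F>" "A \<subseteq> B" "\<not> A \<subset> B"
    unfolding principal_def by blast
  then show "A \<in> \<F>"
    by (metis psubsetI)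
next
  fix A assume A: "A \<in> \<F>"
  have "\<not> A \<subset> C" if "B \<in> \<F>" "C \<subseteq> B" for B C
    using assms[OF A that(1)] that(2) by (metis order.trans psubsetE)
  then show "A \<in> principal (\<Union>A\<in>\<F>. Pow A)"
    using A unfolding principal_def by (simp add: Bex_def) (metis order_refl)
qed

section \<open>Nested complexes and their facets\<close>

definition nested :: "'a set \<Rightarrow> ('a \<Rightarrow> 'a set) \<Rightarrow> bool" where
  "nested F X \<longleftrightarrow> finite F \<and> (\<forall>v\<in>F. finite (X v) \<and> X v \<noteq> {} \<and> X v \<inter> F = {}) \<and>
     (\<forall>u\<in>F. \<forall>v\<in>F. X u \<subseteq> X v \<or> X v \<subseteq> X u)"

text \<open>Across the ridge \<open>F - {v}\<close> of \<open>F\<close> lies one facet, which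
  exchanges \<open>v\<close> for \<open>X v\<close>. For \<open>F = {v}\<close> the ball is the
  simplex on \<open>X v\<close>, and \<open>v\<close> is not one of its vertices.\<close>

definition nested_ball :: "'a set \<Rightarrow> ('a \<Rightarrow> 'a set) \<Rightarrow> 'a set set" where
  "nested_ball F X = (\<Union>v\<in>F. Pow (F - {v} \<union> X v))"

definition nested_sphere :: "'a set \<Rightarrow> ('a \<Rightarrow> 'a set) \<Rightarrow> 'a set set" where
  "nested_sphere F X = Pow F \<union> nested_ball F X"

lemma nestedD:
  assumes "nested F X"
  shows "finite F" "v \<in> F \<Longrightarrow> finite (X v)" "v \<in> F \<Longrightarrow> X v \<noteq> {}" "v \<in> F \<Longrightarrow> X v \<inter> F = {}"
    "u \<in> F \<Longrightarrow> v \<in> F \<Longrightarrow> X u \<subseteq> X v \<or> X v \<subseteq> X u"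
  using assms unfolding nested_def by blast+

lemma nested_ball_empty: "nested_ball {} X = {}"
  by (simp add: nested_ball_def)

lemma nested_sphere_empty: "nested_sphere {} X = {{}}"
  by (simp add: nested_sphere_def nested_ball_empty)

lemma nested_subset: "nested F X \<Longrightarrow> G \<subseteq> F \<Longrightarrow> nested G X"
  unfolding nested_def using finite_subset by blast

lemma fin_complex_nested_ball: "nested F X \<Longrightarrow> fin_complex (nested_ball F X)"
  unfolding nested_ball_def nested_def by (intro fin_complex_UN fin_complex_Pow) auto

lemma fin_complex_nested_sphere: "nested F X \<Longrightarrow> fin_complex (nested_sphere F X)"
  unfolding nested_sphere_def
  by (intro fin_complex_Un fin_complex_nested_ball fin_complex_Pow) (auto simp: nested_def)

text \<open>The facet for \<open>v\<close> omits \<open>v\<close>, while the facets for the other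
  indices contain it.\<close>

lemma nested_exchange_subset:
  assumes "nested F X" "u \<in> F" "v \<in> F" "F - {u} \<union> X u \<subseteq> F - {v} \<union> X v"
  shows "u = v"
  using assms nestedD(4)[OF assms(1) assms(3)] by blast

lemma nested_exchange_not_subset:
  assumes "nested F X" "v \<in> F"
  shows "\<not> F - {v} \<union> X v \<subseteq> F" "\<not> F \<subseteq> F - {v} \<union> X v"
  using assms nestedD(3,4)[OF assms] by blast+

lemma inj_on_nested_exchange: "nested F X \<Longrightarrow> inj_on (\<lambda>v. F - {v} \<union> X v) F"
  by (rule inj_onI) (rule nested_exchange_subset, auto)

lemma principal_nested_ball:
  assumes "nested F X"
  shows "principal (nested_ball F X) = (\<lambda>v. F - {v} \<union> X v) ` F"
proof -
  have "nested_ball F X = (\<Union>A\<in>(\<lambda>v. F - {v} \<union> X v) ` F. Pow A)"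
    unfolding nested_ball_def by blast
  moreover have "A = B" if "A \<in> (\<lambda>v. F - {v} \<union> X v) ` F" "B \<in> (\<lambda>v. F - {v} \<union> X v) ` F" "A \<subseteq> B" for A B
    using that nested_exchange_subset[OF assms] by blast
  ultimately show ?thesis
    by (metis (no_types, lifting) principal_Union_Pow)
qed

lemma principal_nested_sphere:
  assumes "nested F X"
  shows "principal (nested_sphere F X) = insert F ((\<lambda>v. F - {v} \<union> X v) ` F)"
proof -
  have "nested_sphere F X = (\<Union>A\<in>insert F ((\<lambda>v. F - {v} \<union> X v) ` F). Pow A)"
    unfolding nested_sphere_def nested_ball_def by blast
  moreover have "A = B" if "A \<in> insert F ((\<lambda>v. F - {v} \<union> X v) ` F)"
    "B \<in> insert F ((\<lambda>v. F - {v} \<union> X v) ` F)" "A \<subseteq> B" for A B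
    using that nested_exchange_subset[OF assms] nested_exchange_not_subset[OF assms] by blast
  ultimately show ?thesis
    by (metis (no_types, lifting) principal_Union_Pow)
qed

lemma num_principal_nested_sphere:
  assumes "nested F X"
  shows "num_principal (nested_sphere F X) = Suc (card F)"
proof -
  have "F \<notin> (\<lambda>v. F - {v} \<union> X v) ` F"
    using nested_exchange_not_subset(1)[OF assms] by blast
  then show ?thesis
    unfolding num_principal_def principal_nested_sphere[OF assms]
    using nestedD(1)[OF assms] by (simp add: card_image inj_on_nested_exchange[OF assms])
qed

lemma nested_least:
  assumes "nested F X" "F \<noteq> {}"
  shows "\<exists>u\<in>F. \<forall>v\<in>F. X u \<subseteq> X v"
proof -
  obtain A where A: "A \<in> X ` F" "\<forall>B\<in>X ` F. B \<subseteq> A \<longrightarrow> A = B"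
    using finite_has_minimal[of "X ` F"] assms nestedD(1)[OF assms(1)] by auto
  then obtain u where u: "u \<in> F" "A = X u"
    by blast
  have "X u \<subseteq> X v" if "v \<in> F" for v
    using nestedD(5)[OF assms(1) u(1) that] A(2) that u(2) by auto
  then show ?thesis
    using u(1) by (intro bexI ballI)
qed

lemma nested_greatest:
  assumes "nested F X" "F \<noteq> {}"
  shows "\<exists>u\<in>F. \<forall>v\<in>F. X v \<subseteq> X u"
proof -
  obtain A where A: "A \<in> X ` F" "\<forall>B\<in>X ` F. A \<subseteq> B \<longrightarrow> A = B"
    using finite_has_maximal[of "X ` F"] assms nestedD(1)[OF assms(1)] by auto
  then obtain u where u: "u \<in> F" "A = X u"
    by blast
  have "X v \<subseteq> X u" if "v \<in> F" for v
    using nestedD(5)[OF assms(1) u(1) that] A(2) that u(2) by auto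
  then show ?thesis
    using u(1) by (intro bexI ballI)
qed

section \<open>Links in nested complexes\<close>

lemma link_nested_ball:
  assumes "nested F X" "\<tau> \<subseteq> F"
  shows "link \<tau> (nested_ball F X) = nested_ball (F - \<tau>) X"
proof
  show "link \<tau> (nested_ball F X) \<subseteq> nested_ball (F - \<tau>) X"
  proof
    fix \<sigma> assume "\<sigma> \<in> link \<tau> (nested_ball F X)"
    then obtain v where v: "v \<in> F" "\<sigma> \<inter> \<tau> = {}" "\<sigma> \<union> \<tau> \<subseteq> F - {v} \<union> X v"
      unfolding link_def nested_ball_def by auto
    \<comment> \<open>The facet for \<open>v\<close> omits \<open>v\<close>, so it contains
      \<open>\<tau>\<close> only if \<open>v\<close> is not in \<open>\<tau>\<close>.\<close>
    then have "v \<in> F - \<tau>" "\<sigma> \<subseteq> F - \<tau> - {v} \<union> X v"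
      using nestedD(4)[OF assms(1) v(1)] by auto
    then show "\<sigma> \<in> nested_ball (F - \<tau>) X"
      unfolding nested_ball_def by auto
  qed
  show "nested_ball (F - \<tau>) X \<subseteq> link \<tau> (nested_ball F X)"
  proof
    fix \<sigma> assume "\<sigma> \<in> nested_ball (F - \<tau>) X"
    then obtain v where v: "v \<in> F" "v \<notin> \<tau>" "\<sigma> \<subseteq> F - \<tau> - {v} \<union> X v"
      unfolding nested_ball_def by auto
    have "\<sigma> \<inter> \<tau> = {}" "\<sigma> \<union> \<tau> \<subseteq> F - {v} \<union> X v" "\<sigma> \<subseteq> F - {v} \<union> X v"
      using v nestedD(4)[OF assms(1) v(1)] assms(2) by blast+
    then show "\<sigma> \<in> link \<tau> (nested_ball F X)"
      using v(1) unfolding link_def nested_ball_def by auto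
  qed
qed

lemma link_nested_sphere:
  assumes "nested F X" "\<tau> \<subseteq> F"
  shows "link \<tau> (nested_sphere F X) = nested_sphere (F - \<tau>) X"
proof -
  have "\<sigma> \<in> nested_ball F X" if "\<sigma> \<union> \<tau> \<in> nested_ball F X" for \<sigma>
    using fin_complexD(3)[OF fin_complex_nested_ball[OF assms(1)] that] by simp
  then have "link \<tau> (nested_sphere F X) = link \<tau> (Pow F) \<union> link \<tau> (nested_ball F X)"
    by (auto simp: link_def nested_sphere_def)
  also have "link \<tau> (Pow F) = Pow (F - \<tau>)"
    using assms(2) unfolding link_def by blast
  finally show ?thesis
    by (simp add: link_nested_ball[OF assms] nested_sphere_def)
qed

lemma link_nested_sphere_outside:
  assumes "x \<notin> F"
  shows "link {x} (nested_sphere F X) = link {x} (nested_ball F X)"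
  using assms unfolding link_def nested_sphere_def nested_ball_def by auto

text \<open>The facets through \<open>x\<close> are those with \<open>x\<close> in
  \<open>X v\<close>. All of them contain every \<open>w\<close> in \<open>F\<close> with
  \<open>x\<close> outside \<open>X w\<close>; such \<open>w\<close> are no longer exchanged and
  move from \<open>F\<close> into the exchange sets.\<close>

lemma link_nested_ball_outside:
  assumes "nested F X" "x \<notin> F"
  shows "link {x} (nested_ball F X) =
    nested_ball {v\<in>F. x \<in> X v} (\<lambda>v. X v - {x} \<union> {v\<in>F. x \<notin> X v})"
proof (intro equalityI subsetI)
  fix \<sigma> assume "\<sigma> \<in> link {x} (nested_ball F X)"
  then obtain v where v: "v \<in> F" "x \<notin> \<sigma>" "insert x \<sigma> \<subseteq> F - {v} \<union> X v"
    unfolding link_def nested_ball_def by auto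
  then have "x \<in> X v" "\<sigma> \<subseteq> {v\<in>F. x \<in> X v} - {v} \<union> (X v - {x} \<union> {v\<in>F. x \<notin> X v})"
    using assms(2) by auto
  then show "\<sigma> \<in> nested_ball {v\<in>F. x \<in> X v} (\<lambda>v. X v - {x} \<union> {v\<in>F. x \<notin> X v})"
    using v(1) unfolding nested_ball_def by blast
next
  fix \<sigma> assume "\<sigma> \<in> nested_ball {v\<in>F. x \<in> X v} (\<lambda>v. X v - {x} \<union> {v\<in>F. x \<notin> X v})"
  then obtain v where v: "v \<in> F" "x \<in> X v"
    "\<sigma> \<subseteq> {v\<in>F. x \<in> X v} - {v} \<union> (X v - {x} \<union> {v\<in>F. x \<notin> X v})"
    unfolding nested_ball_def by auto
  then have "x \<notin> \<sigma>" "insert x \<sigma> \<subseteq> F - {v} \<union> X v"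
    using assms(2) by auto
  then show "\<sigma> \<in> link {x} (nested_ball F X)"
    using v(1) unfolding link_def nested_ball_def by auto
qed

text \<open>An exchange set of the link is empty only if \<open>X v = {x}\<close> and
  \<open>x\<close> lies in all the sets, which the last assumption excludes.\<close>

lemma nested_link_outside:
  assumes "nested F X" "x \<notin> F" "\<And>v. v \<in> F \<Longrightarrow> X v = {x} \<Longrightarrow> \<exists>u\<in>F. x \<notin> X u"
  shows "nested {v\<in>F. x \<in> X v} (\<lambda>v. X v - {x} \<union> {v\<in>F. x \<notin> X v})"
  unfolding nested_def
proof (intro conjI ballI)
  fix v assume "v \<in> {v\<in>F. x \<in> X v}"
  then have v: "v \<in> F" "x \<in> X v" by auto
  show "finite (X v - {x} \<union> {v\<in>F. x \<notin> X v})"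
    using nestedD(1)[OF assms(1)] nestedD(2)[OF assms(1) v(1)] by simp
  show "X v - {x} \<union> {v \<in> F. x \<notin> X v} \<noteq> {}"
    using assms(3)[OF v(1)] v by blast
  show "(X v - {x} \<union> {v \<in> F. x \<notin> X v}) \<inter> {v \<in> F. x \<in> X v} = {}"
    using nestedD(4)[OF assms(1) v(1)] by blast
next
  fix u v assume "u \<in> {v\<in>F. x \<in> X v}" "v \<in> {v\<in>F. x \<in> X v}"
  then show "X u - {x} \<union> {v \<in> F. x \<notin> X v} \<subseteq> X v - {x} \<union> {v \<in> F. x \<notin> X v} \<or>
     X v - {x} \<union> {v \<in> F. x \<notin> X v} \<subseteq> X u - {x} \<union> {v \<in> F. x \<notin> X v}"
    using nestedD(5)[OF assms(1), of u v] by blast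
qed (use nestedD(1)[OF assms(1)] in simp)

text \<open>If \<open>X u = {x}\<close>, the exchange of \<open>u\<close> becomes the facet \<open>F - {u}\<close> of the link of \<open>x\<close>, so that
  the link is a sphere rather than a ball.\<close>

lemma link_nested_ball_outside_sphere:
  assumes "nested F X" "u \<in> F" "X u = {x}" "\<And>v. v \<in> F \<Longrightarrow> x \<in> X v"
  shows "link {x} (nested_ball F X) = nested_sphere (F - {u}) (\<lambda>v. insert u (X v - {x}))"
    and "nested (F - {u}) (\<lambda>v. insert u (X v - {x}))"
proof -
  have x: "x \<notin> F"
    using assms nestedD(4)[OF assms(1,2)] by blast
  have "{v\<in>F. x \<in> X v} = F" "{v\<in>F. x \<notin> X v} = {}"
    using assms(4) by auto
  then have "link {x} (nested_ball F X) = nested_ball F (\<lambda>v. X v - {x})"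
    unfolding link_nested_ball_outside[OF assms(1) x] by (simp only: Un_empty_right)
  also have "\<dots> = Pow (F - {u}) \<union> (\<Union>v\<in>F - {u}. Pow (F - {v} \<union> (X v - {x})))"
    unfolding nested_ball_def using assms(2,3) by auto
  \<comment> \<open>Every remaining facet contains \<open>u\<close>, which is therefore moved into
    the exchange sets.\<close>
  also have "(\<Union>v\<in>F - {u}. Pow (F - {v} \<union> (X v - {x}))) =
      (\<Union>v\<in>F - {u}. Pow (F - {u} - {v} \<union> insert u (X v - {x})))"
    using assms(2) by (intro SUP_cong) auto
  finally show "link {x} (nested_ball F X) = nested_sphere (F - {u}) (\<lambda>v. insert u (X v - {x}))"
    unfolding nested_sphere_def nested_ball_def .
  show "nested (F - {u}) (\<lambda>v. insert u (X v - {x}))"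
    unfolding nested_def
  proof (intro conjI ballI)
    fix v assume "v \<in> F - {u}"
    then show "insert u (X v - {x}) \<inter> (F - {u}) = {}" "finite (insert u (X v - {x}))"
      using nestedD(2,4)[OF assms(1), of v] by auto
  next
    fix w v assume "w \<in> F - {u}" "v \<in> F - {u}"
    then show "insert u (X w - {x}) \<subseteq> insert u (X v - {x}) \<or> insert u (X v - {x}) \<subseteq> insert u (X w - {x})"
      using nestedD(5)[OF assms(1), of w v] by blast
  qed (use nestedD(1)[OF assms(1)] in auto)
qed

section \<open>Iterated duals\<close>

text \<open>These are the vertices that the dual loses: \<open>{v}\<close> lies in the dual iff
  \<open>verts K - {v}\<close> is not a simplex.\<close>

definition codim_one_verts :: "'a set set \<Rightarrow> 'a set" where
  "codim_one_verts K = {v \<in> verts K. verts K - {v} \<in> K}"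

lemma fin_complex_alexander_dual:
  assumes "fin_complex K"
  shows "fin_complex (alexander_dual K)"
proof -
  have "\<tau> \<in> alexander_dual K" if "\<sigma> \<in> alexander_dual K" "\<tau> \<subseteq> \<sigma>" for \<sigma> \<tau>
    using that fin_complexD(3)[OF assms, of "verts K - \<tau>" "verts K - \<sigma>"]
    unfolding alexander_dual_def alexander_dual_on_def by blast
  moreover have "alexander_dual K \<subseteq> Pow (verts K)"
    unfolding alexander_dual_def alexander_dual_on_def by blast
  ultimately show ?thesis
    unfolding fin_complex_def
    by (meson PowD assms fin_complexD(4) finite_Pow_iff finite_subset subsetD)
qed

lemma verts_alexander_dual:
  assumes "fin_complex K"
  shows "verts (alexander_dual K) = verts K - codim_one_verts K"
  unfolding in_verts_iff[OF fin_complex_alexander_dual[OF assms]] set_eq_iff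
  unfolding alexander_dual_def alexander_dual_on_def codim_one_verts_def by auto

text \<open>The second dual takes complements in \<open>verts K - codim_one_verts K\<close>, the
  first in \<open>verts K\<close>. Composing them sends a simplex to its union with
  \<open>codim_one_verts K\<close> instead of back to itself.\<close>

lemma alexander_dual_dual:
  assumes "fin_complex K"
  shows "alexander_dual (alexander_dual K) = link (codim_one_verts K) K"
proof -
  let ?V = "verts K" and ?T = "codim_one_verts K"
  have T: "?T \<subseteq> ?V"
    unfolding codim_one_verts_def by blast
  have *: "?V - (?V - ?T - \<sigma>) = \<sigma> \<union> ?T" if "\<sigma> \<subseteq> ?V - ?T" for \<sigma>
    using that T by blast
  have "alexander_dual (alexander_dual K) = {\<sigma>. \<sigma> \<subseteq> ?V - ?T \<and> ?V - ?T - \<sigma> \<notin> alexander_dual K}"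
    unfolding alexander_dual_def[of "alexander_dual K"] alexander_dual_on_def
      verts_alexander_dual[OF assms] ..
  also have "\<dots> = {\<sigma>. \<sigma> \<subseteq> ?V - ?T \<and> \<sigma> \<union> ?T \<in> K}"
    unfolding alexander_dual_def alexander_dual_on_def using * by auto
  also have "\<dots> = link ?T K"
  proof -
    have "\<sigma> \<in> K" if "\<sigma> \<union> ?T \<in> K" for \<sigma>
      using fin_complexD(3)[OF assms that] by simp
    then show ?thesis
      unfolding link_def by (auto simp: verts_def)
  qed
  finally show ?thesis .
qed

text \<open>Duality is an involution for a fixed vertex set, so \<open>K\<close> is determined by
  its dual together with \<open>verts K\<close>.\<close>

lemma in_iff_not_in_alexander_dual:
  "\<sigma> \<in> K \<longleftrightarrow> \<sigma> \<subseteq> verts K \<and> verts K - \<sigma> \<notin> alexander_dual K"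
proof (cases "\<sigma> \<subseteq> verts K")
  case True
  then have "verts K - (verts K - \<sigma>) = \<sigma>"
    by blast
  then show ?thesis
    using True unfolding alexander_dual_def alexander_dual_on_def by simp
next
  case False
  then show ?thesis
    by (auto simp: verts_def)
qed

lemma alexander_dual_eq_void_iff:
  assumes "fin_complex K"
  shows "alexander_dual K = {} \<longleftrightarrow> verts K \<in> K"
proof -
  have "alexander_dual K = {} \<longleftrightarrow> {} \<notin> alexander_dual K"
    using fin_complexD(3)[OF fin_complex_alexander_dual[OF assms], of _ "{}"] by auto
  then show ?thesis
    unfolding alexander_dual_def alexander_dual_on_def by simp
qed

text \<open>This reconstructs \<open>K\<close> from its double dual. A simplex that omits some
  \<open>t\<close> in \<open>codim_one_verts K\<close> lies in \<open>verts K - {t}\<close>, which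
  is a simplex by the choice of \<open>t\<close>; any other simplex is that set joined with a
  simplex of its link.\<close>

lemma complex_eq_link_codim_one:
  assumes "fin_complex K"
  shows "K = (\<Union>t\<in>codim_one_verts K. Pow (verts K - {t})) \<union>
    (\<Union>\<rho>\<in>link (codim_one_verts K) K. Pow (\<rho> \<union> codim_one_verts K))"
    (is "K = ?A \<union> ?B")
proof (intro equalityI subsetI)
  fix \<sigma> assume \<sigma>: "\<sigma> \<in> K"
  have V: "\<sigma> \<subseteq> verts K"
    using \<sigma> by (auto simp: verts_def)
  show "\<sigma> \<in> ?A \<union> ?B"
  proof (cases "codim_one_verts K \<subseteq> \<sigma>")
    case True
    then have "\<sigma> - codim_one_verts K \<union> codim_one_verts K = \<sigma>"
      by blast
    then have "\<sigma> - codim_one_verts K \<in> link (codim_one_verts K) K"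
      unfolding link_def using \<sigma> fin_complexD(3)[OF assms \<sigma>, of "\<sigma> - codim_one_verts K"] by auto
    then show ?thesis by blast
  next
    case False
    then show ?thesis using V by blast
  qed
next
  fix \<sigma> assume "\<sigma> \<in> ?A \<union> ?B"
  then consider t where "t \<in> codim_one_verts K" "\<sigma> \<subseteq> verts K - {t}"
    | \<rho> where "\<rho> \<in> link (codim_one_verts K) K" "\<sigma> \<subseteq> \<rho> \<union> codim_one_verts K"
    by blast
  then show "\<sigma> \<in> K"
  proof cases
    case 1
    then show ?thesis
      using fin_complexD(3)[OF assms, of "verts K - {t}" \<sigma>] by (simp add: codim_one_verts_def)
  next
    case 2
    then show ?thesis
      using fin_complexD(3)[OF assms, of "\<rho> \<union> codim_one_verts K" \<sigma>] by (simp add: link_def)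
  qed
qed

lemma iterated_dual_void: "iterated_dual m {} = {}"
  by (induction m) auto

lemma iterated_dual_Suc: "K \<noteq> {} \<Longrightarrow> iterated_dual (Suc m) K = iterated_dual m (alexander_dual K)"
  by (induction m) auto

text \<open>As \<open>verts K\<close> is not a simplex, the dual is not void, and the sequence does
  not stop after one step.\<close>

lemma iterated_dual_Suc_Suc:
  assumes "fin_complex K" "K \<noteq> {}" "verts K \<notin> K"
  shows "iterated_dual (Suc (Suc m)) K = iterated_dual m (link (codim_one_verts K) K)"
  using assms alexander_dual_eq_void_iff[OF assms(1)]
  by (simp only: iterated_dual_Suc alexander_dual_dual not_False_eq_True)

text \<open>Strong induction on \<open>m\<close> in steps of two, hence the base cases
  \<open>m = 0\<close> and \<open>m = 1\<close>. Since \<open>Q\<close> fails for the void complex,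
  a sequence that reaches \<open>Q\<close> has not become void before.\<close>

lemma double_dual_induct:
  assumes "fin_complex K" "Q (iterated_dual m K)" "\<not> Q {}"
    and 0: "\<And>K. fin_complex K \<Longrightarrow> Q K \<Longrightarrow> P K"
    and 1: "\<And>K. fin_complex K \<Longrightarrow> K \<noteq> {} \<Longrightarrow> Q (alexander_dual K) \<Longrightarrow> P K"
    and 2: "\<And>K. fin_complex K \<Longrightarrow> verts K \<notin> K \<Longrightarrow> P (link (codim_one_verts K) K) \<Longrightarrow> P K"
  shows "P K"
  using assms(1,2)
proof (induction m arbitrary: K rule: less_induct)
  case (less m)
  consider "m = 0" | "m = 1" | j where "m = Suc (Suc j)"
    by (metis One_nat_def not0_implies_Suc)
  then show ?case
  proof cases
    case 1
    then show ?thesis using 0 less.prems by simp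
  next
    case 2
    then have "K \<noteq> {}" "Q (alexander_dual K)"
      using less.prems(2) assms(3) by (auto split: if_splits)
    then show ?thesis using 1 less.prems(1) by blast
  next
    case (3 j)
    have K: "K \<noteq> {}"
      using iterated_dual_void[of m] less.prems assms(3) by metis
    have "Q (iterated_dual (Suc j) (alexander_dual K))"
      using less.prems(2) unfolding 3 iterated_dual_Suc[OF K] .
    then have "alexander_dual K \<noteq> {}"
      using iterated_dual_void[of "Suc j"] assms(3) by metis
    then have V: "verts K \<notin> K"
      using alexander_dual_eq_void_iff[OF less.prems(1)] by blast
    have "Q (iterated_dual j (link (codim_one_verts K) K))"
      using less.prems(2) unfolding 3 iterated_dual_Suc_Suc[OF less.prems(1) K V] .
    moreover have "fin_complex (link (codim_one_verts K) K)"
      unfolding alexander_dual_dual[OF less.prems(1), symmetric]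
      by (intro fin_complex_alexander_dual less.prems(1))
    ultimately show ?thesis
      using 2[OF less.prems(1) V] less.IH[of j] 3 by simp
  qed
qed

section \<open>From an iterated dual back to the complex\<close>

lemma simplex_boundary_nested_sphere:
  assumes "finite V" "V \<noteq> {}"
  shows "\<exists>F X. nested F X \<and> Pow V - {V} = nested_sphere F X"
proof -
  obtain q where q: "q \<in> V"
    using assms by blast
  have "nested (V - {q}) (\<lambda>_. {q})"
    using assms(1) unfolding nested_def by simp
  moreover have "Pow V - {V} = nested_sphere (V - {q}) (\<lambda>_. {q})"
    unfolding nested_sphere_def nested_ball_def using q by auto
  ultimately show ?thesis
    by blast
qed

text \<open>Let \<open>V\<close> be \<open>verts K\<close>. A set is in \<open>K\<close> iff its
  complement is not a proper subset of \<open>Q\<close>, that is, iff it omits a vertex outside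
  \<open>Q\<close> or equals \<open>V - Q\<close>. This is the sphere over \<open>V - Q\<close> with
  all exchange sets equal to \<open>Q\<close>.\<close>

lemma nested_sphere_if_dual_simplex_boundary:
  assumes "fin_complex K" "K \<noteq> {}" "is_simplex_boundary d (alexander_dual K)"
  shows "\<exists>F X. nested F X \<and> K = nested_sphere F X"
proof -
  obtain Q where Q: "finite Q" "card Q = Suc d" "alexander_dual K = Pow Q - {Q}"
    using assms(3) unfolding is_simplex_boundary_def by blast
  let ?V = "verts K"
  have in_K: "\<sigma> \<in> K \<longleftrightarrow> \<sigma> \<subseteq> ?V \<and> \<not> (?V - \<sigma> \<subseteq> Q \<and> ?V - \<sigma> \<noteq> Q)" for \<sigma>
  proof -
    have "\<sigma> \<in> K \<longleftrightarrow> \<sigma> \<subseteq> ?V \<and> ?V - \<sigma> \<notin> alexander_dual K"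
      by (rule in_iff_not_in_alexander_dual)
    then show ?thesis
      unfolding Q(3) by simp
  qed
  \<comment> \<open>For \<open>d = 0\<close> the dual is \<open>{{}}\<close>, which has no vertices,
    so \<open>Q\<close> need not lie in \<open>verts K\<close>. In this case \<open>K\<close> itself
    is the boundary of a simplex.\<close>
  show ?thesis
  proof (cases "d = 0")
    case True
    then obtain q where "Q = {q}"
      using Q(2) by (auto simp: card_1_singleton_iff)
    then have dual: "alexander_dual K = {{}}"
      unfolding Q(3) by auto
    have "\<sigma> \<in> K \<longleftrightarrow> \<sigma> \<subseteq> ?V \<and> \<sigma> \<noteq> ?V" for \<sigma>
      using in_iff_not_in_alexander_dual[of \<sigma> K] unfolding dual by auto
    then have K: "K = Pow ?V - {?V}"
      by auto
    have "?V \<noteq> {}"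
      using assms(2) K by (metis Diff_cancel Pow_empty)
    then show ?thesis
      using simplex_boundary_nested_sphere[of ?V] fin_complexD(4)[OF assms(1)] K by metis
  next
    case False
    have "{q} \<in> Pow Q - {Q}" if "q \<in> Q" for q
      using that Q(2) False by auto
    then have "verts (alexander_dual K) = Q"
      unfolding Q(3) by (auto simp: verts_def)
    then have QV: "Q \<subseteq> ?V"
      unfolding verts_alexander_dual[OF assms(1)] by blast
    have "Q \<noteq> {}"
      using Q(2) by auto
    then have n: "nested (?V - Q) (\<lambda>_. Q)"
      using Q(1) fin_complexD(4)[OF assms(1)] unfolding nested_def by auto
    have "\<sigma> \<in> K \<longleftrightarrow> \<sigma> \<in> nested_sphere (?V - Q) (\<lambda>_. Q)" for \<sigma>
      unfolding in_K nested_sphere_def nested_ball_def using QV by auto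
    then show ?thesis
      using n by blast
  qed
qed

text \<open>Here a set is in \<open>K\<close> iff it omits a vertex outside \<open>Q\<close>, so the
  facets are the complements of single vertices outside \<open>Q\<close>.\<close>

lemma nested_ball_if_dual_simplex:
  assumes "fin_complex K" "K \<noteq> {}" "is_simplex d (alexander_dual K)"
  shows "\<exists>F X. nested F X \<and> F \<noteq> {} \<and> K = nested_ball F X"
proof -
  obtain Q where Q: "finite Q" "card Q = Suc d" "alexander_dual K = Pow Q"
    using assms(3) unfolding is_simplex_def by blast
  let ?V = "verts K"
  have in_K: "\<sigma> \<in> K \<longleftrightarrow> \<sigma> \<subseteq> ?V \<and> \<not> ?V - \<sigma> \<subseteq> Q" for \<sigma>
  proof -
    have "\<sigma> \<in> K \<longleftrightarrow> \<sigma> \<subseteq> ?V \<and> ?V - \<sigma> \<notin> alexander_dual K"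
      by (rule in_iff_not_in_alexander_dual)
    then show ?thesis
      unfolding Q(3) by simp
  qed
  have "verts (alexander_dual K) = Q"
    unfolding Q(3) by (auto simp: verts_def)
  then have QV: "Q \<subseteq> ?V"
    unfolding verts_alexander_dual[OF assms(1)] by blast
  have "Q \<noteq> {}"
    using Q(2) by auto
  then have n: "nested (?V - Q) (\<lambda>_. Q)"
    using Q(1) fin_complexD(4)[OF assms(1)] unfolding nested_def by auto
  have *: "\<sigma> \<in> K \<longleftrightarrow> \<sigma> \<in> nested_ball (?V - Q) (\<lambda>_. Q)" for \<sigma>
    unfolding in_K nested_ball_def using QV by auto
  moreover have "?V - Q \<noteq> {}"
    using assms(2) * by (auto simp: nested_ball_def)
  ultimately show ?thesis
    using n by blast
qed

text \<open>The double dual is undone by giving each \<open>t\<close> in \<open>T\<close> the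
  greatest exchange set available, \<open>V - T - F\<close>, so that its facet becomes
  \<open>V - {t}\<close>. The resulting union has the shape of
  \<open>complex_eq_link_codim_one\<close>.\<close>

lemma nested_extend:
  assumes n: "nested F X" and "finite V" "T \<subseteq> V" "F \<subseteq> V - T" "V - T - F \<noteq> {}"
    and XV: "\<And>v. v \<in> F \<Longrightarrow> X v \<subseteq> V - T"
  shows "nested (F \<union> T) (\<lambda>v. if v \<in> F then X v else V - T - F)"
    and "nested_ball (F \<union> T) (\<lambda>v. if v \<in> F then X v else V - T - F) =
      (\<Union>t\<in>T. Pow (V - {t})) \<union> (\<Union>\<rho>\<in>nested_ball F X. Pow (\<rho> \<union> T))"
proof -
  let ?X = "\<lambda>v. if v \<in> F then X v else V - T - F"
  have *: "X v \<subseteq> V - T - F" if "v \<in> F" for v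
    using XV[OF that] nestedD(4)[OF n that] by blast
  show "nested (F \<union> T) ?X"
    unfolding nested_def
  proof (intro conjI ballI)
    show "finite (F \<union> T)"
      using assms(2-4) by (auto intro: finite_subset)
  next
    fix v assume "v \<in> F \<union> T"
    show "finite (?X v)" "?X v \<noteq> {}"
      using nestedD(2,3)[OF n, of v] assms(2,5) by auto
    show "?X v \<inter> (F \<union> T) = {}"
      using * by auto
  next
    fix u v assume "u \<in> F \<union> T" "v \<in> F \<union> T"
    then show "?X u \<subseteq> ?X v \<or> ?X v \<subseteq> ?X u"
      using nestedD(5)[OF n, of u v] *[of u] *[of v] by auto
  qed
  have "nested_ball (F \<union> T) ?X =
      (\<Union>t\<in>T. Pow (F \<union> T - {t} \<union> ?X t)) \<union> (\<Union>v\<in>F. Pow (F \<union> T - {v} \<union> ?X v))"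
    unfolding nested_ball_def by blast
  also have "(\<Union>t\<in>T. Pow (F \<union> T - {t} \<union> ?X t)) = (\<Union>t\<in>T. Pow (V - {t}))"
    using assms(3,4) by (intro SUP_cong refl arg_cong[where f = Pow]) auto
  also have "(\<Union>v\<in>F. Pow (F \<union> T - {v} \<union> ?X v)) = (\<Union>v\<in>F. Pow ((F - {v} \<union> X v) \<union> T))"
    using assms(3,4) by (intro SUP_cong refl arg_cong[where f = Pow]) auto
  also have "\<dots> = (\<Union>\<rho>\<in>nested_ball F X. Pow (\<rho> \<union> T))"
  proof (intro equalityI subsetI)
    fix \<sigma> assume "\<sigma> \<in> (\<Union>v\<in>F. Pow ((F - {v} \<union> X v) \<union> T))"
    then obtain v where "v \<in> F" "\<sigma> \<subseteq> (F - {v} \<union> X v) \<union> T"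
      by blast
    moreover from this have "F - {v} \<union> X v \<in> nested_ball F X"
      unfolding nested_ball_def by blast
    ultimately show "\<sigma> \<in> (\<Union>\<rho>\<in>nested_ball F X. Pow (\<rho> \<union> T))"
      by (intro UN_I PowI)
  next
    fix \<sigma> assume "\<sigma> \<in> (\<Union>\<rho>\<in>nested_ball F X. Pow (\<rho> \<union> T))"
    then obtain v \<rho> where "v \<in> F" "\<rho> \<subseteq> F - {v} \<union> X v" "\<sigma> \<subseteq> \<rho> \<union> T"
      unfolding nested_ball_def by auto
    then show "\<sigma> \<in> (\<Union>v\<in>F. Pow ((F - {v} \<union> X v) \<union> T))"
      by (intro UN_I[of v] PowI) auto
  qed
  finally show "nested_ball (F \<union> T) ?X =
      (\<Union>t\<in>T. Pow (V - {t})) \<union> (\<Union>\<rho>\<in>nested_ball F X. Pow (\<rho> \<union> T))" .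
qed

lemma nested_sphere_if_link:
  assumes K: "fin_complex K" "verts K \<notin> K"
    and n: "nested F X" and link: "link (codim_one_verts K) K = nested_sphere F X"
  shows "\<exists>F X. nested F X \<and> K = nested_sphere F X"
proof -
  let ?V = "verts K" and ?T = "codim_one_verts K"
  let ?X = "\<lambda>v. if v \<in> F then X v else ?V - ?T - F"
  have T: "?T \<subseteq> ?V"
    by (auto simp: codim_one_verts_def)
  have sub: "\<rho> \<subseteq> ?V - ?T" if "\<rho> \<in> nested_sphere F X" for \<rho>
    using that unfolding link[symmetric] link_def verts_def by blast
  have F: "F \<in> nested_sphere F X"
    by (simp add: nested_sphere_def)
  have "X v \<subseteq> ?V - ?T" if "v \<in> F" for v
    using sub[of "X v"] that by (auto simp: nested_sphere_def nested_ball_def)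
  \<comment> \<open>Otherwise the simplex \<open>F \<union> ?T\<close> would contain all vertices of
    \<open>K\<close>.\<close>
  moreover have "?V - ?T - F \<noteq> {}"
  proof
    assume "?V - ?T - F = {}"
    then have "?V = F \<union> ?T"
      using sub[OF F] T by blast
    moreover have "F \<union> ?T \<in> K"
      using F unfolding link[symmetric] by (simp add: link_def)
    ultimately show False
      using K(2) by simp
  qed
  ultimately have e: "nested (F \<union> ?T) ?X" "nested_ball (F \<union> ?T) ?X =
      (\<Union>t\<in>?T. Pow (?V - {t})) \<union> (\<Union>\<rho>\<in>nested_ball F X. Pow (\<rho> \<union> ?T))"
    using nested_extend[OF n fin_complexD(4)[OF K(1)] T sub[OF F]] by auto
  have "K = (\<Union>t\<in>?T. Pow (?V - {t})) \<union> (\<Union>\<rho>\<in>nested_sphere F X. Pow (\<rho> \<union> ?T))"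
    unfolding link[symmetric] by (rule complex_eq_link_codim_one[OF K(1)])
  also have "(\<Union>\<rho>\<in>nested_sphere F X. Pow (\<rho> \<union> ?T)) =
      Pow (F \<union> ?T) \<union> (\<Union>\<rho>\<in>nested_ball F X. Pow (\<rho> \<union> ?T))"
    unfolding nested_sphere_def by auto
  finally have "K = nested_sphere (F \<union> ?T) ?X"
    unfolding nested_sphere_def e(2) by blast
  then show ?thesis
    using e(1) by blast
qed

lemma nested_ball_if_link:
  assumes K: "fin_complex K" "verts K \<notin> K"
    and n: "nested F X" "F \<noteq> {}" and link: "link (codim_one_verts K) K = nested_ball F X"
  shows "\<exists>F X. nested F X \<and> F \<noteq> {} \<and> K = nested_ball F X"
proof -
  let ?V = "verts K" and ?T = "codim_one_verts K"
  have T: "?T \<subseteq> ?V"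
    by (auto simp: codim_one_verts_def)
  have sub: "\<rho> \<subseteq> ?V - ?T" if "\<rho> \<in> nested_ball F X" for \<rho>
    using that unfolding link[symmetric] link_def verts_def by blast
  \<comment> \<open>For \<open>F = {v}\<close> the index \<open>v\<close> is not a vertex of the
    link and may lie in \<open>?T\<close> or outside \<open>?V\<close>. It is replaced by a vertex
    \<open>w\<close> outside \<open>X v \<union> ?T\<close>, which exists because that union is a
    simplex and \<open>?V\<close> is not.\<close>
  have "\<exists>G Y. nested G Y \<and> G \<noteq> {} \<and> nested_ball F X = nested_ball G Y \<and> G \<subseteq> ?V - ?T"
  proof (cases "F \<subseteq> ?V - ?T")
    case True
    then show ?thesis using n by blast
  next
    case False
    then obtain v where v: "v \<in> F" "v \<notin> ?V - ?T" by blast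
    have "u = v" if "u \<in> F" for u
    proof (rule ccontr)
      assume "u \<noteq> v"
      then have "{v} \<in> nested_ball F X"
        using v that by (auto simp: nested_ball_def)
      then show False using sub v by blast
    qed
    then have "F = {v}"
      using v by blast
    then have ball: "nested_ball F X = Pow (X v)"
      by (simp add: nested_ball_def)
    have "X v \<union> ?T \<in> K"
      using link unfolding ball by (auto simp: link_def)
    then have "?V \<noteq> X v \<union> ?T"
      using K(2) by auto
    moreover have "X v \<subseteq> ?V - ?T"
      using sub[of "X v"] unfolding ball by blast
    ultimately obtain w where w: "w \<in> ?V - ?T" "w \<notin> X v"
      using T by blast
    have "nested {w} (\<lambda>_. X v)"
      using nestedD[OF n(1)] v(1) w(2) unfolding nested_def by simp
    moreover have "nested_ball F X = nested_ball {w} (\<lambda>_. X v)"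
      unfolding ball by (simp add: nested_ball_def)
    ultimately show ?thesis
      using w(1) by blast
  qed
  then obtain G Y where G: "nested G Y" "G \<noteq> {}" "nested_ball F X = nested_ball G Y" "G \<subseteq> ?V - ?T"
    by blast
  let ?X = "\<lambda>v. if v \<in> G then Y v else ?V - ?T - G"
  have XV: "Y v \<subseteq> ?V - ?T" if "v \<in> G" for v
    using sub[of "Y v"] that unfolding G(3) by (auto simp: nested_ball_def)
  moreover have "?V - ?T - G \<noteq> {}"
  proof -
    obtain v where "v \<in> G" using G(2) by blast
    then show ?thesis
      using nestedD(3,4)[OF G(1)] XV by blast
  qed
  ultimately have e: "nested (G \<union> ?T) ?X" "nested_ball (G \<union> ?T) ?X =
      (\<Union>t\<in>?T. Pow (?V - {t})) \<union> (\<Union>\<rho>\<in>nested_ball G Y. Pow (\<rho> \<union> ?T))"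
    using nested_extend[OF G(1) fin_complexD(4)[OF K(1)] T G(4)] by auto
  have "K = nested_ball (G \<union> ?T) ?X"
    unfolding e(2) G(3)[symmetric] link[symmetric] by (rule complex_eq_link_codim_one[OF K(1)])
  then show ?thesis
    using e(1) G(2) by blast
qed

lemma nested_sphere_if_iterated_dual:
  assumes "fin_complex K" "is_simplex_boundary d (iterated_dual m K)"
  shows "\<exists>F X. nested F X \<and> K = nested_sphere F X"
proof (rule double_dual_induct[where Q = "is_simplex_boundary d"
      and P = "\<lambda>K. \<exists>F X. nested F X \<and> K = nested_sphere F X", OF assms])
  have "{} \<in> Pow V - {V}" if "card V = Suc d" for V :: "'a set"
    using that by auto
  then show "\<not> is_simplex_boundary d ({} :: 'a set set)"
    unfolding is_simplex_boundary_def by (metis empty_iff)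
next
  fix K :: "'a set set" assume "is_simplex_boundary d K"
  then obtain V where V: "finite V" "card V = Suc d" and K: "K = Pow V - {V}"
    unfolding is_simplex_boundary_def by blast
  show "\<exists>F X. nested F X \<and> K = nested_sphere F X"
    unfolding K by (rule simplex_boundary_nested_sphere) (use V in auto)
next
  fix K :: "'a set set" assume "fin_complex K" "K \<noteq> {}" "is_simplex_boundary d (alexander_dual K)"
  then show "\<exists>F X. nested F X \<and> K = nested_sphere F X"
    by (rule nested_sphere_if_dual_simplex_boundary)
next
  fix K :: "'a set set"
  assume "fin_complex K" "verts K \<notin> K"
    "\<exists>F X. nested F X \<and> link (codim_one_verts K) K = nested_sphere F X"
  then show "\<exists>F X. nested F X \<and> K = nested_sphere F X"
    by (elim exE conjE) (rule nested_sphere_if_link)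
qed

lemma nested_ball_if_iterated_dual:
  fixes K :: "'a::infinite set set"
  assumes "fin_complex K" "is_simplex d (iterated_dual m K)"
  shows "\<exists>F X. nested F X \<and> F \<noteq> {} \<and> K = nested_ball F X"
proof (rule double_dual_induct[where Q = "is_simplex d"
      and P = "\<lambda>K. \<exists>F X. nested F X \<and> F \<noteq> {} \<and> K = nested_ball F X", OF assms])
  show "\<not> is_simplex d {}"
    unfolding is_simplex_def by auto
next
  fix K :: "'a set set" assume "is_simplex d K"
  then obtain V where V: "finite V" "card V = Suc d" "K = Pow V"
    unfolding is_simplex_def by blast
  \<comment> \<open>The infinite vertex type provides an index for the only facet
    \<open>V\<close>.\<close>
  obtain w where "w \<notin> V"
    using ex_new_if_finite[OF infinite_UNIV V(1)] by blast
  then have "nested {w} (\<lambda>_. V)" "K = nested_ball {w} (\<lambda>_. V)"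
    using V by (auto simp: nested_def nested_ball_def)
  then show "\<exists>F X. nested F X \<and> F \<noteq> {} \<and> K = nested_ball F X"
    by blast
next
  fix K :: "'a set set" assume "fin_complex K" "K \<noteq> {}" "is_simplex d (alexander_dual K)"
  then show "\<exists>F X. nested F X \<and> F \<noteq> {} \<and> K = nested_ball F X"
    by (rule nested_ball_if_dual_simplex)
next
  fix K :: "'a set set"
  assume "fin_complex K" "verts K \<notin> K"
    "\<exists>F X. nested F X \<and> F \<noteq> {} \<and> link (codim_one_verts K) K = nested_ball F X"
  then show "\<exists>F X. nested F X \<and> F \<noteq> {} \<and> K = nested_ball F X"
    by (elim exE conjE) (rule nested_ball_if_link)
qed

section \<open>Iterated duals of nested complexes\<close>

lemma verts_nested:
  assumes "nested F X" "u \<in> F" "\<forall>v\<in>F. X v \<subseteq> X u"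
  shows "verts (nested_sphere F X) = F \<union> X u"
    and "F \<noteq> {u} \<Longrightarrow> verts (nested_ball F X) = F \<union> X u"
proof -
  show "verts (nested_sphere F X) = F \<union> X u"
    using assms(2,3) by (auto simp: verts_def nested_sphere_def nested_ball_def)
  assume "F \<noteq> {u}"
  then obtain w where "w \<in> F" "w \<noteq> u"
    using assms(2) by blast
  then show "verts (nested_ball F X) = F \<union> X u"
    using assms(2,3) by (auto simp: verts_def nested_ball_def)
qed

text \<open>If the facet for \<open>w\<close> contains all vertices but \<open>v\<close>, then
  \<open>v = w\<close> and \<open>X w\<close> is as large as \<open>X u\<close>. In the sphere
  \<open>F\<close> itself has codimension one exactly when \<open>X u\<close> is a singleton; the
  sphere is then the boundary of a simplex, which accounts for the disjunction.\<close>

lemma codim_one_verts_nested: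
  assumes "nested F X" "u \<in> F" "\<forall>v\<in>F. X v \<subseteq> X u"
  shows "is_singleton (X u) \<or> codim_one_verts (nested_sphere F X) = {v \<in> F. X v = X u}"
    and "F \<noteq> {u} \<Longrightarrow> codim_one_verts (nested_ball F X) = {v \<in> F. X v = X u}"
    and "F \<union> X u \<notin> nested_sphere F X"
proof -
  have disj: "X v \<inter> F = {}" if "v \<in> F" for v
    using nestedD(4)[OF assms(1) that] .
  have *: "v \<in> F \<and> X v = X u"
    if "w \<in> F" "F \<union> X u - {v} \<subseteq> F - {w} \<union> X w" for v w
  proof -
    have vw: "v = w"
      using that disj[OF that(1)] by blast
    have "X u \<subseteq> X w"
      using that disj[OF assms(2)] unfolding vw by auto
    then show ?thesis
      using that(1) assms(3) vw by auto
  qed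
  have **: "F \<union> X u - {v} = F - {v} \<union> X v" if "v \<in> F" "X v = X u" for v
    using that(1) disj[OF that(1)] unfolding that(2) by auto
  have in_ball: "v \<in> F \<union> X u \<and> F \<union> X u - {v} \<in> nested_ball F X \<longleftrightarrow> v \<in> F \<and> X v = X u" for v
  proof
    assume "v \<in> F \<union> X u \<and> F \<union> X u - {v} \<in> nested_ball F X"
    then obtain w where "w \<in> F" "F \<union> X u - {v} \<subseteq> F - {w} \<union> X w"
      unfolding nested_ball_def by auto
    then show "v \<in> F \<and> X v = X u"
      by (rule *)
  next
    assume v: "v \<in> F \<and> X v = X u"
    then show "v \<in> F \<union> X u \<and> F \<union> X u - {v} \<in> nested_ball F X"
      using **[of v] unfolding nested_ball_def by auto
  qed
  then show "F \<noteq> {u} \<Longrightarrow> codim_one_verts (nested_ball F X) = {v \<in> F. X v = X u}"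
    unfolding codim_one_verts_def by (simp add: verts_nested(2)[OF assms])
  show "is_singleton (X u) \<or> codim_one_verts (nested_sphere F X) = {v \<in> F. X v = X u}"
  proof (cases "is_singleton (X u)")
    case False
    have "F \<union> X u - {v} \<notin> Pow F" for v
    proof
      assume "F \<union> X u - {v} \<in> Pow F"
      then have "X u \<subseteq> {v}"
        using disj[OF assms(2)] by blast
      then show False
        using False nestedD(3)[OF assms(1,2)] by (metis is_singletonI subset_singletonD)
    qed
    then show ?thesis
      using in_ball unfolding codim_one_verts_def verts_nested(1)[OF assms]
      by (auto simp: nested_sphere_def)
  qed simp
  show "F \<union> X u \<notin> nested_sphere F X"
  proof
    assume "F \<union> X u \<in> nested_sphere F X"
    then consider "X u \<subseteq> F" | v where "v \<in> F" "F \<subseteq> F - {v} \<union> X v"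
      unfolding nested_sphere_def nested_ball_def by auto
    then show False
      using disj[OF assms(2)] nestedD(3)[OF assms(1,2)] nested_exchange_not_subset(2)[OF assms(1)]
      by cases auto
  qed
qed

text \<open>Each double dual removes at least \<open>u\<close> from \<open>F\<close>. The process
  ends when \<open>F\<close> is empty or its greatest exchange set is a singleton, and in both cases
  a boundary of a simplex is reached.\<close>

lemma iterated_dual_nested_sphere:
  assumes "nested F X"
  shows "\<exists>m d. is_simplex_boundary d (iterated_dual m (nested_sphere F X))"
  using assms
proof (induction "card F" arbitrary: F rule: less_induct)
  case less
  show ?case
  proof (cases "F = {}")
    case True
    \<comment> \<open>\<open>{{}}\<close> is the boundary of the simplex on any one vertex.\<close>
    have "is_simplex_boundary 0 (nested_sphere F X)"
      unfolding True nested_sphere_empty is_simplex_boundary_def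
      by (rule exI[of _ "{undefined}"]) auto
    then show ?thesis
      by (metis iterated_dual.simps(1))
  next
    case False
    then obtain u where u: "u \<in> F" "\<forall>v\<in>F. X v \<subseteq> X u"
      using nested_greatest[OF less.prems] by blast
    note codim = codim_one_verts_nested[OF less.prems u]
    show ?thesis
    proof (cases "is_singleton (X u)")
      case True
      then obtain w where w: "X u = {w}"
        by (auto simp: is_singleton_def)
      have X: "X v = {w}" if "v \<in> F" for v
        using bspec[OF u(2) that] nestedD(3)[OF less.prems that] unfolding w
        by (simp add: subset_singleton_iff)
      have "w \<notin> F"
        using nestedD(4)[OF less.prems u(1)] w by blast
      then have "nested_sphere F X = Pow (insert w F) - {insert w F}"
        unfolding nested_sphere_def nested_ball_def using X by auto
      then have "is_simplex_boundary (card F) (nested_sphere F X)"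
        unfolding is_simplex_boundary_def using nestedD(1)[OF less.prems] \<open>w \<notin> F\<close>
        by (intro exI[of _ "insert w F"]) auto
      then show ?thesis
        by (metis iterated_dual.simps(1))
    next
      case False
      let ?T = "{v \<in> F. X v = X u}"
      have T: "codim_one_verts (nested_sphere F X) = ?T"
        using codim(1) False by blast
      have "card (F - ?T) < card F"
        using nestedD(1)[OF less.prems] u(1) by (intro psubset_card_mono) auto
      then obtain m d where "is_simplex_boundary d (iterated_dual m (nested_sphere (F - ?T) X))"
        using less.hyps nested_subset[OF less.prems] by (metis Diff_subset)
      moreover have "nested_sphere F X \<noteq> {}"
        by (auto simp: nested_sphere_def)
      moreover have "link ?T (nested_sphere F X) = nested_sphere (F - ?T) X"
        by (rule link_nested_sphere[OF less.prems]) blast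
      ultimately have "is_simplex_boundary d (iterated_dual (Suc (Suc m)) (nested_sphere F X))"
        using iterated_dual_Suc_Suc[OF fin_complex_nested_sphere[OF less.prems]] codim(3) T
        by (metis verts_nested(1)[OF less.prems u])
      then show ?thesis by blast
    qed
  qed
qed

lemma iterated_dual_nested_ball:
  assumes "nested F X" "F \<noteq> {}"
  shows "\<exists>m d. is_simplex d (iterated_dual m (nested_ball F X))"
  using assms
proof (induction "card F" arbitrary: F rule: less_induct)
  case less
  obtain u where u: "u \<in> F" "\<forall>v\<in>F. X v \<subseteq> X u"
    using nested_greatest[OF less.prems] by blast
  note codim = codim_one_verts_nested[OF less.prems(1) u]
  have simplex: "is_simplex (card (X u) - 1) (Pow (X u))"
    unfolding is_simplex_def using nestedD(2,3)[OF less.prems(1) u(1)]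
    by (intro exI[of _ "X u"]) (auto simp: card_gt_0_iff)
  have ne: "nested_ball F X \<noteq> {}"
    using u(1) by (auto simp: nested_ball_def)
  show ?case
  proof (cases "F = {u}")
    case True
    then have "nested_ball F X = Pow (X u)"
      by (simp add: nested_ball_def)
    then show ?thesis
      using simplex by (metis iterated_dual.simps(1))
  next
    case False
    let ?T = "{v \<in> F. X v = X u}"
    have V: "verts (nested_ball F X) = F \<union> X u"
      by (rule verts_nested(2)[OF less.prems(1) u False])
    \<comment> \<open>If all exchange sets agree, the double dual would already be void, but the
      single dual is a simplex: the complement of a set lies in the ball iff the set meets
      \<open>F\<close>, so the dual consists of the subsets of \<open>X u\<close>.\<close>
    show ?thesis
    proof (cases "?T = F")
      case True
      then have X: "X v = X u" if "v \<in> F" for v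
        using that by blast
      have disj: "X u \<inter> F = {}"
        using nestedD(4)[OF less.prems(1) u(1)] .
      have "F \<union> X u - \<sigma> \<in> nested_ball F X \<longleftrightarrow> (\<exists>v\<in>F. v \<in> \<sigma>)" for \<sigma>
        unfolding nested_ball_def using X disj by auto
      then have "alexander_dual (nested_ball F X) = Pow (X u)"
        unfolding alexander_dual_def alexander_dual_on_def V using disj by auto
      then have "is_simplex (card (X u) - 1) (iterated_dual (Suc 0) (nested_ball F X))"
        using simplex ne by simp
      then show ?thesis by blast
    next
      case not_F: False
      have "card (F - ?T) < card F"
        using nestedD(1)[OF less.prems(1)] u(1) by (intro psubset_card_mono) auto
      moreover have "F - ?T \<noteq> {}"
        using not_F by blast
      moreover have "nested (F - ?T) X"
        by (rule nested_subset[OF less.prems(1)]) blast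
      ultimately have "\<exists>m d. is_simplex d (iterated_dual m (nested_ball (F - ?T) X))"
        using less.hyps by simp
      then obtain m d where "is_simplex d (iterated_dual m (nested_ball (F - ?T) X))"
        by blast
      moreover have "link ?T (nested_ball F X) = nested_ball (F - ?T) X"
        by (rule link_nested_ball[OF less.prems(1)]) blast
      moreover have V': "verts (nested_ball F X) \<notin> nested_ball F X"
        using codim(3) unfolding V nested_sphere_def by blast
      ultimately have "is_simplex d (iterated_dual (Suc (Suc m)) (nested_ball F X))"
        unfolding iterated_dual_Suc_Suc[OF fin_complex_nested_ball[OF less.prems(1)] ne V']
          codim(2)[OF False] by simp
      then show ?thesis by blast
    qed
  qed
qed

section \<open>Nested balls and spheres are NH-balls and NH-spheres\<close>

text \<open>The bounds on the dimension of a link are left out here, as they hold automatically; see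
  \<open>nh_manifold_if_links\<close>.\<close>

definition nh_ball_or_sphere :: "'a set set \<Rightarrow> bool" where
  "nh_ball_or_sphere L \<longleftrightarrow> (\<exists>k. nh_ball k L) \<or> (\<exists>k h. nh_sphere k h L)"

lemma nh_manifoldD:
  assumes "nh_manifold d M"
  shows "fin_complex M" "has_dim M d"
  using assms by (auto elim: nh_manifold.cases)

lemma nh_manifold_edgeless:
  assumes "v \<in> A" "finite A"
  shows "nh_manifold 0 (insert {} ((\<lambda>v. {v}) ` A))"
proof (rule nh_manifold_nh_ball_nh_sphere.manifold_0)
  show "fin_complex (insert {} ((\<lambda>v. {v}) ` A))"
    unfolding fin_complex_def using assms(2) by (auto simp: subset_singleton_iff)
  show "has_dim (insert {} ((\<lambda>v. {v}) ` A)) 0"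
    unfolding has_dim_def using assms(1) by auto
qed

lemma nh_ball_imp_manifold: "nh_ball d B \<Longrightarrow> nh_manifold d B"
proof (erule nh_ball.cases)
  fix v assume "d = 0" "B = {{}, {v}}"
  then show ?thesis
    using nh_manifold_edgeless[of v "{v}"] by simp
qed simp

lemma nh_sphere_imp_manifold:
  assumes "nh_sphere k h S"
  shows "k = - 1 \<and> S = {{}} \<or> (\<exists>d. k = int d \<and> nh_manifold d S)"
  using assms
proof (cases rule: nh_sphere.cases)
  case (sphere_0 v w)
  then show ?thesis
    using nh_manifold_edgeless[of v "{v, w}"] by auto
qed auto

section \<open>Relabelling of vertices and collapsing of cones\<close>

lemma geom_simplex_vertex: "finite \<sigma> \<Longrightarrow> a \<in> \<sigma> \<Longrightarrow> (\<lambda>b. if b = a then 1 else 0) \<in> geom_simplex \<sigma>"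
  by (auto simp: geom_simplex_def)

text \<open>This yields the subdivisions on natural numbers that \<open>combinatorial_ball\<close>
  and \<open>collapsible\<close> ask for. The vertex \<open>f a\<close> is placed at the vertex
  \<open>a\<close>, so the affine extension merely renames coordinates.\<close>

lemma subdivides_relabel:
  assumes K: "fin_complex K" and f: "inj_on f (verts K)"
  shows "subdivides ((`) f ` K) K"
  unfolding subdivides_def
proof (intro conjI exI)
  let ?V = "verts K" and ?J = "(`) f ` K"
  let ?p = "\<lambda>u b. if b = inv_into (verts K) f u then 1 else (0::real)"
  have sub: "\<sigma> \<subseteq> ?V" if "\<sigma> \<in> K" for \<sigma>
    using that by (auto simp: verts_def)
  have V: "verts ?J = f ` ?V"
    by (auto simp: verts_def)
  have finV: "finite ?V"
    by (rule fin_complexD(4)[OF K])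
  show "fin_complex ?J"
    unfolding fin_complex_def
  proof (intro conjI ballI allI impI)
    show "finite ?J"
      using fin_complexD(1)[OF K] by simp
  next
    fix \<sigma> assume "\<sigma> \<in> ?J"
    then show "finite \<sigma>"
      using fin_complexD(2)[OF K] by auto
  next
    fix \<sigma> \<tau> assume "\<sigma> \<in> ?J" "\<tau> \<subseteq> \<sigma>"
    then obtain \<rho> where \<rho>: "\<rho> \<in> K" "\<tau> \<subseteq> f ` \<rho>" by auto
    then obtain \<rho>' where "\<rho>' \<subseteq> \<rho>" "\<tau> = f ` \<rho>'"
      by (auto simp: subset_image_iff)
    then show "\<tau> \<in> ?J"
      using fin_complexD(3)[OF K \<rho>(1)] by auto
  qed
  show "fin_complex K" by fact
  show "(?J = {}) = (K = {})" by simp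
  show "\<forall>\<sigma>\<in>?J. \<exists>\<tau>\<in>K. ?p ` \<sigma> \<subseteq> geom_simplex \<tau>"
  proof
    fix \<sigma> assume "\<sigma> \<in> ?J"
    then obtain \<rho> where \<rho>: "\<rho> \<in> K" "\<sigma> = f ` \<rho>" by auto
    have "?p ` \<sigma> \<subseteq> geom_simplex \<rho>"
    proof
      fix q assume "q \<in> ?p ` \<sigma>"
      then obtain a where "a \<in> \<rho>" "q = ?p (f a)"
        using \<rho>(2) by auto
      moreover have "inv_into ?V f (f a) = a" if "a \<in> \<rho>" for a
        using f sub[OF \<rho>(1)] that by (intro inv_into_f_f) auto
      ultimately show "q \<in> geom_simplex \<rho>"
        using geom_simplex_vertex[OF fin_complexD(2)[OF K \<rho>(1)]] by simp
    qed
    then show "\<exists>\<tau>\<in>K. ?p ` \<sigma> \<subseteq> geom_simplex \<tau>"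
      using \<rho>(1) by blast
  qed
  have ext: "affine_ext ?J ?p x a = (if a \<in> ?V then x (f a) else 0)" for x a
  proof -
    have "affine_ext ?J ?p x a = (\<Sum>b\<in>?V. x (f b) * ?p (f b) a)"
      unfolding affine_ext_def V using f by (simp add: sum.reindex)
    also have "\<dots> = (\<Sum>b\<in>?V. if b = a then x (f a) else 0)"
      using f by (intro sum.cong) (auto simp: inv_into_f_f)
    finally show ?thesis
      using finV by (simp add: sum.delta')
  qed
  let ?g = "\<lambda>y u. if u \<in> f ` ?V then y (inv_into ?V f u) else (0::real)"
  have sum_f: "(\<Sum>u\<in>f ` \<sigma>. x u) = (\<Sum>a\<in>\<sigma>. x (f a))" if "\<sigma> \<in> K" for \<sigma> and x :: "'b \<Rightarrow> real"
    using inj_on_subset[OF f sub[OF that]] by (simp add: sum.reindex)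
  show "bij_betw (affine_ext ?J ?p) (realization ?J) (realization K)"
  proof (rule bij_betw_byWitness[where f' = ?g])
    show "\<forall>x\<in>realization ?J. ?g (affine_ext ?J ?p x) = x"
    proof
      fix x assume "x \<in> realization ?J"
      then obtain \<sigma> where \<sigma>: "\<sigma> \<in> K" "x \<in> geom_simplex (f ` \<sigma>)"
        unfolding realization_def by auto
      then have "x u = 0" if "u \<notin> f ` ?V" for u
        using that sub[OF \<sigma>(1)] unfolding geom_simplex_def by blast
      then show "?g (affine_ext ?J ?p x) = x"
        unfolding ext fun_eq_iff using f by (auto simp: inv_into_f_f)
    qed
    show "\<forall>y\<in>realization K. affine_ext ?J ?p (?g y) = y"
    proof
      fix y assume "y \<in> realization K"
      then obtain \<sigma> where \<sigma>: "\<sigma> \<in> K" "y \<in> geom_simplex \<sigma>"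
        unfolding realization_def by auto
      then have "y a = 0" if "a \<notin> ?V" for a
        using that sub[OF \<sigma>(1)] unfolding geom_simplex_def by blast
      then show "affine_ext ?J ?p (?g y) = y"
        unfolding ext fun_eq_iff using f by (auto simp: inv_into_f_f)
    qed
    show "affine_ext ?J ?p ` realization ?J \<subseteq> realization K"
    proof
      fix y assume "y \<in> affine_ext ?J ?p ` realization ?J"
      then obtain \<sigma> x where \<sigma>: "\<sigma> \<in> K" "x \<in> geom_simplex (f ` \<sigma>)" "y = affine_ext ?J ?p x"
        unfolding realization_def by auto
      have y: "y a = (if a \<in> ?V then x (f a) else 0)" for a
        unfolding \<sigma>(3) ext ..
      have "f a \<notin> f ` \<sigma>" if "a \<in> ?V" "a \<notin> \<sigma>" for a
        using f that sub[OF \<sigma>(1)] by (auto dest: inj_onD)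
      then have "y \<in> geom_simplex \<sigma>"
        using \<sigma>(2) sub[OF \<sigma>(1)] sum_f[OF \<sigma>(1), of x]
        unfolding geom_simplex_def y by (auto simp: subset_iff intro!: sum.cong[THEN trans])
      then show "y \<in> realization K"
        using \<sigma>(1) unfolding realization_def by blast
    qed
    show "?g ` realization K \<subseteq> realization ?J"
    proof
      fix x assume "x \<in> ?g ` realization K"
      then obtain \<sigma> y where \<sigma>: "\<sigma> \<in> K" "y \<in> geom_simplex \<sigma>" "x = ?g y"
        unfolding realization_def by auto
      have xf: "x (f a) = y a" if "a \<in> ?V" for a
        using that f unfolding \<sigma>(3) by (simp add: inv_into_f_f)
      have "(\<Sum>u\<in>f ` \<sigma>. x u) = (\<Sum>a\<in>\<sigma>. y a)"
        unfolding sum_f[OF \<sigma>(1)] using sub[OF \<sigma>(1)] xf by (intro sum.cong) auto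
      moreover have "x u = 0" if u: "u \<notin> f ` \<sigma>" for u
      proof (cases "u \<in> f ` ?V")
        case True
        then obtain a where "a \<in> ?V" "u = f a" by blast
        then show ?thesis
          using xf u \<sigma>(2) unfolding geom_simplex_def by auto
      qed (simp add: \<sigma>(3))
      moreover have "0 \<le> x u" for u
        using \<sigma>(2) unfolding \<sigma>(3) geom_simplex_def by simp
      ultimately have "x \<in> geom_simplex (f ` \<sigma>)"
        using \<sigma>(2) unfolding geom_simplex_def by simp
      then show "x \<in> realization ?J"
        using \<sigma>(1) unfolding realization_def by blast
    qed
  qed
qed

lemma combinatorial_ball_Pow:
  assumes "finite F" "card F = Suc k"
  shows "combinatorial_ball k (Pow F)"
proof -
  have relabel: "subdivides (Pow {0..k}) (Pow A)" if A: "finite A" "card A = Suc k" for A :: "'b set"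
  proof -
    obtain f where f: "bij_betw f A {0..k}"
      using ex_bij_betw_finite_nat[OF A(1)] A(2)
      by (metis atLeastLessThanSuc_atLeastAtMost)
    then have "(`) f ` Pow A = Pow {0..k}"
      by (simp add: bij_betw_def image_Pow_surj)
    moreover have "verts (Pow A) = A"
      by (simp add: verts_def)
    ultimately show ?thesis
      using subdivides_relabel[OF fin_complex_Pow[OF A(1)], of f] f by (simp add: bij_betw_def)
  qed
  show ?thesis
    unfolding combinatorial_ball_def
    using relabel[OF assms] relabel[of "{0..k}"] by (metis card_atLeastAtMost diff_zero finite_atLeastAtMost)
qed

text \<open>A maximal nonempty simplex \<open>\<sigma>\<close> without the apex has
  \<open>insert x \<sigma>\<close> as its only proper coface. Removing this pair leaves a smaller
  cone with the same apex.\<close>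

lemma cone_collapses:
  assumes "fin_complex K" "K \<noteq> {}" "\<And>\<sigma>. \<sigma> \<in> K \<Longrightarrow> insert x \<sigma> \<in> K"
  shows "elem_collapse\<^sup>*\<^sup>* K {{}, {x}}"
  using assms
proof (induction "card K" arbitrary: K rule: less_induct)
  case less
  note K = fin_complexD[OF less.prems(1)]
  have apex: "{} \<in> K" "{x} \<in> K"
    using K(3) less.prems(2,3) by blast+
  show ?case
  proof (cases "K = {{}, {x}}")
    case True
    then show ?thesis by simp
  next
    case False
    then obtain \<rho> where \<rho>: "\<rho> \<in> K" "\<rho> \<noteq> {}" "\<rho> \<noteq> {x}"
      using apex by blast
    let ?A = "{\<sigma> \<in> K. x \<notin> \<sigma> \<and> \<sigma> \<noteq> {}}"
    have "\<rho> - {x} \<in> ?A"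
      using \<rho> K(3)[OF \<rho>(1), of "\<rho> - {x}"] by auto
    then obtain \<sigma> where \<sigma>: "\<sigma> \<in> ?A" "\<forall>\<tau>\<in>?A. \<sigma> \<subseteq> \<tau> \<longrightarrow> \<sigma> = \<tau>"
      using finite_has_maximal[of ?A] K(1) by auto
    have only: "\<tau> = insert x \<sigma>" if "\<tau> \<in> K" "\<sigma> \<subset> \<tau>" for \<tau>
    proof -
      have "\<tau> - {x} \<in> ?A" "\<sigma> \<subseteq> \<tau> - {x}"
        using that \<sigma>(1) K(3)[OF that(1), of "\<tau> - {x}"] by auto
      then have "\<sigma> = \<tau> - {x}"
        using \<sigma>(2) by simp
      then show ?thesis
        using that(2) by auto
    qed
    let ?K = "K - {\<sigma>, insert x \<sigma>}"
    have step: "elem_collapse K ?K"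
      unfolding elem_collapse_def
      using \<sigma>(1) only less.prems(3) by (intro exI[of _ \<sigma>] exI[of _ "insert x \<sigma>"]) auto
    have "fin_complex ?K"
      unfolding fin_complex_def
    proof (intro conjI ballI allI impI)
      fix \<rho> \<tau> assume \<rho>: "\<rho> \<in> ?K" "\<tau> \<subseteq> \<rho>"
      have "\<tau> \<noteq> \<sigma>" "\<tau> \<noteq> insert x \<sigma>"
        using \<rho> only[of \<rho>] \<sigma>(1) by auto
      then show "\<tau> \<in> ?K"
        using K(3)[of \<rho> \<tau>] \<rho> by simp
    qed (use K(1,2) in auto)
    moreover have "insert x \<tau> \<in> ?K" if "\<tau> \<in> ?K" for \<tau>
      using that less.prems(3)[of \<tau>] \<sigma>(1) by (auto simp: insert_eq_iff)
    moreover have "{} \<in> ?K"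
      using apex \<sigma>(1) by auto
    moreover have "card ?K < card K"
      using K(1) \<sigma>(1) by (intro psubset_card_mono) auto
    ultimately have "elem_collapse\<^sup>*\<^sup>* ?K {{}, {x}}"
      using less.hyps[of ?K] by blast
    then show ?thesis
      using step by (rule converse_rtranclp_into_rtranclp[rotated])
  qed
qed

lemma cone_collapsible:
  assumes K: "fin_complex K" "K \<noteq> {}" and cone: "\<And>\<sigma>. \<sigma> \<in> K \<Longrightarrow> insert x \<sigma> \<in> K"
  shows "collapsible K"
proof -
  obtain f :: "'a \<Rightarrow> nat" where f: "inj_on f (verts K)"
    using finite_imp_inj_to_nat_seg[OF fin_complexD(4)[OF K(1)]] by blast
  have J: "subdivides ((`) f ` K) K"
    by (rule subdivides_relabel[OF K(1) f])
  have "elem_collapse\<^sup>*\<^sup>* ((`) f ` K) {{}, {f x}}"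
  proof (rule cone_collapses)
    show "fin_complex ((`) f ` K)"
      using J unfolding subdivides_def by blast
    show "insert (f x) \<sigma> \<in> (`) f ` K" if "\<sigma> \<in> (`) f ` K" for \<sigma>
      using that cone by (auto simp flip: image_insert)
  qed (use K(2) in simp)
  then show ?thesis
    unfolding collapsible_def using J by blast
qed

section \<open>Nested complexes as NH-manifolds\<close>

lemma ex_has_dim:
  assumes "fin_complex K" "\<sigma> \<in> K" "\<sigma> \<noteq> {}"
  shows "\<exists>d. has_dim K d"
proof -
  let ?m = "Max (card ` K)"
  have fin: "finite (card ` K)"
    using fin_complexD(1)[OF assms(1)] by simp
  have "card \<sigma> \<le> ?m" "0 < card \<sigma>"
    using fin assms fin_complexD(2)[OF assms(1,2)] by (auto simp: card_gt_0_iff)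
  then have "0 < ?m"
    by simp
  then obtain d where d: "?m = Suc d"
    using gr0_conv_Suc by blast
  have "?m \<in> card ` K"
    using fin assms(2) by (intro Max_in) auto
  then have "\<exists>\<tau>\<in>K. card \<tau> = Suc d"
    unfolding d by auto
  moreover have "card \<tau> \<le> Suc d" if "\<tau> \<in> K" for \<tau>
    using Max_ge[OF fin, of "card \<tau>"] that unfolding d by simp
  ultimately have "has_dim K d"
    unfolding has_dim_def by blast
  then show ?thesis ..
qed

text \<open>Adding \<open>v\<close> to a top simplex of its link gives a simplex of
  \<open>M\<close>, so the link has smaller dimension than \<open>M\<close>.\<close>

lemma nh_manifold_if_links:
  assumes "fin_complex M" "has_dim M d" "1 \<le> d"
    "\<And>v. v \<in> verts M \<Longrightarrow> nh_ball_or_sphere (link {v} M)"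
  shows "nh_manifold d M"
proof (rule nh_manifold_nh_ball_nh_sphere.manifold[OF assms(3,1,2)], rule ballI)
  fix v assume v: "v \<in> verts M"
  have dim: "Suc k \<le> d" if k: "has_dim (link {v} M) k" for k
  proof -
    obtain \<sigma> where \<sigma>: "\<sigma> \<in> link {v} M" "card \<sigma> = Suc k"
      using k unfolding has_dim_def by blast
    then have "insert v \<sigma> \<in> M" "v \<notin> \<sigma>" "finite \<sigma>"
      unfolding link_def using fin_complexD(2)[OF assms(1)] by auto
    then have "Suc (Suc k) \<le> Suc d"
      using assms(2) \<sigma>(2) unfolding has_dim_def by (metis card_insert_disjoint)
    then show ?thesis by simp
  qed
  consider k where "nh_ball k (link {v} M)" | k h where "nh_sphere k h (link {v} M)"
    using assms(4)[OF v] unfolding nh_ball_or_sphere_def by blast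
  then show "(\<exists>k. k \<le> d - 1 \<and> nh_ball k (link {v} M)) \<or>
        (\<exists>k h. - 1 \<le> k \<and> k \<le> int d - 1 \<and> nh_sphere k h (link {v} M))"
  proof cases
    case 1
    then have "Suc k \<le> d"
      by (intro dim nh_manifoldD(2) nh_ball_imp_manifold)
    then show ?thesis
      using 1 by (intro disjI1 exI[of _ k]) auto
  next
    case 2
    have "- 1 \<le> k \<and> k \<le> int d - 1"
      using nh_sphere_imp_manifold[OF 2] dim nh_manifoldD(2) assms(3) by fastforce
    then show ?thesis
      using 2 by blast
  qed
qed

text \<open>Every vertex link is nested over a set of points that no longer contains
  \<open>v\<close>, so the induction hypothesis applies. It is stated for nonempty \<open>G\<close>
  because \<open>nested_ball {} Y\<close> is void; the sphere for \<open>G = {}\<close> is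
  \<open>{{}}\<close>.\<close>

lemma link_nested_nh_ball_or_sphere:
  assumes n: "nested F X"
    and IH: "\<And>G Y. nested G Y \<Longrightarrow> G \<noteq> {} \<Longrightarrow> G \<union> \<Union> (Y ` G) \<subset> F \<union> \<Union> (X ` F) \<Longrightarrow>
      nh_ball_or_sphere (nested_ball G Y) \<and> nh_ball_or_sphere (nested_sphere G Y)"
  shows "v \<in> verts (nested_ball F X) \<Longrightarrow> nh_ball_or_sphere (link {v} (nested_ball F X))"
    and "v \<in> verts (nested_sphere F X) \<Longrightarrow> nh_ball_or_sphere (link {v} (nested_sphere F X))"
proof -
  let ?V = "F \<union> \<Union> (X ` F)"
  have IH': "nh_ball_or_sphere (nested_sphere G Y)" if "nested G Y" "G \<union> \<Union> (Y ` G) \<subset> ?V" for G Y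
  proof (cases "G = {}")
    case True
    show ?thesis
      unfolding True nested_sphere_empty nh_ball_or_sphere_def
      using nh_manifold_nh_ball_nh_sphere.sphere_minus_1 by metis
  next
    case False
    show ?thesis
      using IH[OF that(1) False that(2)] by simp
  qed
  have disj: "X w \<inter> F = {}" if "w \<in> F" for w
    using nestedD(4)[OF n that] .
  have inside: "nested (F - {v}) X \<and> F - {v} \<union> \<Union> (X ` (F - {v})) \<subset> ?V" if "v \<in> F"
  proof
    show "nested (F - {v}) X"
      by (rule nested_subset[OF n]) blast
    have "v \<notin> F - {v} \<union> \<Union> (X ` (F - {v}))"
      using disj that by auto
    moreover have "F - {v} \<union> \<Union> (X ` (F - {v})) \<subseteq> ?V"
      by auto
    ultimately show "F - {v} \<union> \<Union> (X ` (F - {v})) \<subset> ?V"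
      using that by (metis UnI1 psubsetI)
  qed
  have outside: "nh_ball_or_sphere (link {v} (nested_ball F X))"
    if v: "v \<notin> F" "v \<in> verts (nested_sphere F X)"
  proof -
    obtain w where w: "w \<in> F" "v \<in> X w"
      using v by (auto simp: nested_sphere_def nested_ball_def verts_def)
    then have vV: "v \<in> ?V"
      by auto
    \<comment> \<open>The link of an outer vertex is a sphere if exchanging \<open>u\<close> for
      \<open>v\<close> alone leaves the facet \<open>F - {u}\<close>, and a ball otherwise.\<close>
    show ?thesis
    proof (cases "\<exists>u\<in>F. X u = {v} \<and> (\<forall>w\<in>F. v \<in> X w)")
      case True
      then obtain u where u: "u \<in> F" "X u = {v}" "\<And>w. w \<in> F \<Longrightarrow> v \<in> X w"
        by blast
      let ?Y = "\<lambda>w. insert u (X w - {v})"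
      have "v \<notin> F - {u} \<union> \<Union> (?Y ` (F - {u}))"
        using v(1) u(1) by auto
      moreover have "F - {u} \<union> \<Union> (?Y ` (F - {u})) \<subseteq> ?V"
        using u(1) by auto
      ultimately have "F - {u} \<union> \<Union> (?Y ` (F - {u})) \<subset> ?V"
        using vV by (metis psubsetI)
      then show ?thesis
        using link_nested_ball_outside_sphere[OF n u(1,2)] u(3) IH' by simp
    next
      case False
      let ?G = "{w \<in> F. v \<in> X w}" and ?Y = "\<lambda>w. X w - {v} \<union> {w \<in> F. v \<notin> X w}"
      have "nested ?G ?Y"
        using False by (intro nested_link_outside[OF n v(1)]) blast
      moreover have "?G \<union> \<Union> (?Y ` ?G) \<subset> ?V"
      proof (rule psubsetI)
        show "?G \<union> \<Union> (?Y ` ?G) \<subseteq> ?V"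
          by auto
        have "v \<notin> ?G \<union> \<Union> (?Y ` ?G)"
          using v(1) by auto
        then show "?G \<union> \<Union> (?Y ` ?G) \<noteq> ?V"
          using vV by (metis (no_types, lifting))
      qed
      moreover have "?G \<noteq> {}"
        using w by blast
      ultimately show ?thesis
        unfolding link_nested_ball_outside[OF n v(1)] using IH by simp
    qed
  qed
  show "nh_ball_or_sphere (link {v} (nested_ball F X))" if v: "v \<in> verts (nested_ball F X)"
  proof (cases "v \<in> F")
    case True
    \<comment> \<open>The ball over \<open>{v}\<close> does not have \<open>v\<close> as a
      vertex.\<close>
    have "F - {v} \<noteq> {}"
      using v True disj by (auto simp: verts_def nested_ball_def)
    then show ?thesis
      using link_nested_ball[OF n, of "{v}"] inside[OF True] True IH by simp
  next
    case False
    then show ?thesis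
      using outside v by (simp add: nested_sphere_def verts_def)
  qed
  show "nh_ball_or_sphere (link {v} (nested_sphere F X))" if v: "v \<in> verts (nested_sphere F X)"
  proof (cases "v \<in> F")
    case True
    then show ?thesis
      using link_nested_sphere[OF n, of "{v}"] inside[OF True] IH' by simp
  next
    case False
    then show ?thesis
      using outside v by (simp add: link_nested_sphere_outside)
  qed
qed

lemma nested_ball_cone:
  assumes "nested F X" "F \<noteq> {}"
  shows "\<exists>x. \<forall>\<sigma>\<in>nested_ball F X. insert x \<sigma> \<in> nested_ball F X"
proof -
  obtain u where u: "u \<in> F" "\<forall>v\<in>F. X u \<subseteq> X v"
    using nested_least[OF assms] by blast
  then obtain x where "x \<in> X u"
    using nestedD(3)[OF assms(1)] by blast
  then have x: "x \<in> X v" if "v \<in> F" for v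
    using u(2) that by auto
  have "insert x \<sigma> \<in> nested_ball F X" if "\<sigma> \<in> nested_ball F X" for \<sigma>
    using that x unfolding nested_ball_def by auto
  then show ?thesis by blast
qed

lemma top_generated_nested_ball:
  assumes "nested F X"
  shows "top_generated (nested_ball F X) (nested_sphere F X)"
  unfolding top_generated_def principal_nested_ball[OF assms] principal_nested_sphere[OF assms]
  using fin_complex_nested_ball[OF assms] by (auto simp: nested_sphere_def)

lemma top_generated_nested_Pow:
  assumes "nested F X"
  shows "top_generated (Pow F) (nested_sphere F X)"
proof -
  have "principal (Pow F) = {F}"
    unfolding principal_def by blast
  then show ?thesis
    unfolding top_generated_def principal_nested_sphere[OF assms]
    using fin_complex_Pow[OF nestedD(1)[OF assms]] by (auto simp: nested_sphere_def)
qed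

text \<open>The facet for \<open>v\<close> meets \<open>F\<close> in the ridge
  \<open>F - {v}\<close>. As \<open>F\<close> is the only \<open>k\<close>-simplex of
  \<open>Pow F\<close>, all its ridges belong to the boundary.\<close>

lemma nested_ball_Int_Pow:
  assumes n: "nested F X" and k: "card F = Suc k"
  shows "nested_ball F X \<inter> Pow F = ball_boundary k (Pow F)"
proof -
  have fin: "finite F"
    using nestedD(1)[OF n] .
  have uniq: "\<exists>!\<sigma>. \<sigma> \<in> Pow F \<and> card \<sigma> = Suc k \<and> \<rho> \<subseteq> \<sigma>" if "\<rho> \<subseteq> F" for \<rho>
    using that fin k by (intro ex1I[of _ F]) (auto simp: card_subset_eq)
  show ?thesis
  proof (intro equalityI subsetI)
    fix \<tau> assume "\<tau> \<in> nested_ball F X \<inter> Pow F"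
    then obtain v where v: "v \<in> F" "\<tau> \<subseteq> F - {v} \<union> X v" "\<tau> \<subseteq> F"
      unfolding nested_ball_def by auto
    then have "\<tau> \<subseteq> F - {v}"
      using nestedD(4)[OF n v(1)] by blast
    moreover have "card (F - {v}) = k"
      using k v(1) by simp
    ultimately show "\<tau> \<in> ball_boundary k (Pow F)"
      unfolding ball_boundary_def using uniq[of "F - {v}"]
      by (intro CollectI bexI[of _ "F - {v}"] conjI) auto
  next
    fix \<tau> assume "\<tau> \<in> ball_boundary k (Pow F)"
    then obtain \<rho> where \<rho>: "\<rho> \<subseteq> F" "\<tau> \<subseteq> \<rho>" "card \<rho> = k"
      unfolding ball_boundary_def by auto
    then have "\<rho> \<noteq> F"
      using k by auto
    then obtain v where "v \<in> F" "v \<notin> \<rho>"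
      using \<rho>(1) by blast
    then show "\<tau> \<in> nested_ball F X \<inter> Pow F"
      unfolding nested_ball_def using \<rho> by blast
  qed
qed

text \<open>Induction on the number of points in \<open>F\<close> and the sets \<open>X v\<close>,
  which drops in every vertex link. The simplex \<open>F\<close> is the ball \<open>L\<close> of the
  decomposition, hence the homotopy dimension \<open>card F - 1\<close>.\<close>

lemma nested_nh:
  assumes "nested F X" "F \<noteq> {}"
  shows "\<exists>d. nh_ball d (nested_ball F X) \<and> nh_sphere (int d) (int (card F - 1)) (nested_sphere F X)"
  using assms
proof (induction "card (F \<union> \<Union> (X ` F))" arbitrary: F X rule: less_induct)
  case less
  note n = less.prems(1)
  let ?B = "nested_ball F X" and ?S = "nested_sphere F X"
  have finV: "finite (F \<union> \<Union> (X ` F))"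
    using nestedD(1,2)[OF n] by auto
  have IH: "nh_ball_or_sphere (nested_ball G Y) \<and> nh_ball_or_sphere (nested_sphere G Y)"
    if "nested G Y" "G \<noteq> {}" "G \<union> \<Union> (Y ` G) \<subset> F \<union> \<Union> (X ` F)" for G Y
    using less.hyps[OF psubset_card_mono[OF finV that(3)] that(1,2)]
    unfolding nh_ball_or_sphere_def by blast
  note links = link_nested_nh_ball_or_sphere[OF n IH]
  obtain v where v: "v \<in> F"
    using less.prems(2) by blast
  obtain x where x: "\<And>\<sigma>. \<sigma> \<in> ?B \<Longrightarrow> insert x \<sigma> \<in> ?B"
    using nested_ball_cone[OF less.prems] by blast
  have facet: "F - {v} \<union> X v \<in> ?B" if "v \<in> F" for v
    using that unfolding nested_ball_def by blast
  have "F - {v} \<union> X v \<noteq> {}"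
    using nestedD(3)[OF n v] by blast
  then obtain d where d: "has_dim ?B d"
    using ex_has_dim[OF fin_complex_nested_ball[OF n] facet[OF v]] by blast
  have card_facet: "card (F - {v} \<union> X v) = card F - 1 + card (X v)" "1 \<le> card (X v)" if "v \<in> F" for v
  proof -
    show "card (F - {v} \<union> X v) = card F - 1 + card (X v)"
      using nestedD(1)[OF n] nestedD(2,4)[OF n that] that by (subst card_Un_disjoint) auto
    show "1 \<le> card (X v)"
      using nestedD(2,3)[OF n that] by (simp add: Suc_le_eq card_gt_0_iff)
  qed
  have facet_le: "card (F - {v} \<union> X v) \<le> Suc d" if "v \<in> F" for v
    using d facet[OF that] unfolding has_dim_def by blast
  have cF: "1 \<le> card F"
    using nestedD(1)[OF n] less.prems(2) by (simp add: Suc_le_eq card_gt_0_iff)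
  \<comment> \<open>Adding \<open>F\<close> to the ball does not raise the dimension, since
    exchanging \<open>v\<close> for a nonempty set does not lower the number of vertices.\<close>
  have dS: "has_dim ?S d"
  proof -
    have "card \<sigma> \<le> Suc d" if "\<sigma> \<subseteq> F" for \<sigma>
      using card_mono[OF nestedD(1)[OF n] that] facet_le[OF v] card_facet[OF v] cF by linarith
    then show ?thesis
      using d unfolding has_dim_def nested_sphere_def by auto
  qed
  have ball: "nh_ball d ?B"
  proof (cases "d = 0")
    case True
    have "\<sigma> = {} \<or> \<sigma> = {x}" if "\<sigma> \<in> ?B" for \<sigma>
    proof -
      have "card (insert x \<sigma>) \<le> 1" "finite \<sigma>"
        using x[OF that] d fin_complexD(2)[OF fin_complex_nested_ball[OF n] that]
        unfolding True has_dim_def by auto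
      then have "{x} = insert x \<sigma>"
        by (intro card_seteq) auto
      then show ?thesis
        by auto
    qed
    moreover have "{} \<in> ?B"
      using v unfolding nested_ball_def by blast
    moreover from this have "{x} \<in> ?B"
      using x by blast
    ultimately have "?B = {{}, {x}}" by blast
    then show ?thesis
      unfolding True by (simp add: nh_manifold_nh_ball_nh_sphere.ball_0)
  next
    case False
    have "nh_manifold d ?B"
      using False links(1) by (intro nh_manifold_if_links fin_complex_nested_ball n d) auto
    moreover have "collapsible ?B"
      using facet[OF v] by (intro cone_collapsible[OF fin_complex_nested_ball[OF n] _ x]) auto
    ultimately show ?thesis
      using False by (intro nh_manifold_nh_ball_nh_sphere.ball) auto
  qed
  have sphere: "nh_sphere (int d) (int (card F - 1)) ?S"
  proof (cases "d = 0")
    case True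
    have "card F = 1" "card (X v) = 1"
      using card_facet[OF v] facet_le[OF v] cF True by linarith+
    then obtain w where w: "F = {v}" "X v = {w}"
      using v by (metis card_1_singletonE singletonD)
    then have "?S = {{}, {v}, {w}}" "v \<noteq> w"
      using nestedD(4)[OF n v] by (auto simp: nested_sphere_def nested_ball_def)
    then show ?thesis
      unfolding True w(1) by (simp add: nh_manifold_nh_ball_nh_sphere.sphere_0)
  next
    case False
    have "nh_manifold d ?S"
      using False links(2) by (intro nh_manifold_if_links fin_complex_nested_sphere n dS) auto
    then show ?thesis
      using False ball top_generated_nested_ball[OF n] top_generated_nested_Pow[OF n] cF
        combinatorial_ball_Pow[OF nestedD(1)[OF n], of "card F - 1"]
        nested_ball_Int_Pow[OF n, of "card F - 1"]
      by (intro nh_manifold_nh_ball_nh_sphere.sphere[where B = ?B and L = "Pow F"])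
        (auto simp: nested_sphere_def)
  qed
  show ?case
    using ball sphere by blast
qed

lemma minimal_nh_sphere_nested:
  assumes "nested F X"
  shows "minimal_nh_sphere (nested_sphere F X)"
proof (cases "F = {}")
  case True
  have "num_principal (nested_sphere F X) = 1"
    using num_principal_nested_sphere[OF assms] True by simp
  then show ?thesis
    unfolding minimal_nh_sphere_def True nested_sphere_empty
    by (intro exI[of _ "- 1"] conjI nh_manifold_nh_ball_nh_sphere.sphere_minus_1) simp
next
  case False
  then have "1 \<le> card F"
    using nestedD(1)[OF assms] by (simp add: Suc_le_eq card_gt_0_iff)
  then have "int (num_principal (nested_sphere F X)) = int (card F - 1) + 2"
    by (simp add: num_principal_nested_sphere[OF assms])
  then show ?thesis
    using nested_nh[OF assms False] unfolding minimal_nh_sphere_def by blast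
qed

lemma minimal_nh_ball_nested:
  assumes "nested F X" "F \<noteq> {}"
  shows "minimal_nh_ball (nested_ball F X)"
proof -
  let ?k = "card F - 1"
  have k: "card F = Suc ?k"
    using assms(2) nestedD(1)[OF assms(1)] by (simp add: card_gt_0_iff)
  obtain d where d: "nh_ball d (nested_ball F X)" "nh_sphere (int d) (int ?k) (nested_sphere F X)"
    using nested_nh[OF assms] by blast
  have "int (num_principal (nested_sphere F X)) = int ?k + 2"
    using k by (simp add: num_principal_nested_sphere[OF assms(1)])
  moreover have "nh_decomposition d ?k (nested_sphere F X) (nested_ball F X) (Pow F)"
    unfolding nh_decomposition_def
    using d(1) top_generated_nested_ball[OF assms(1)] top_generated_nested_Pow[OF assms(1)]
      combinatorial_ball_Pow[OF nestedD(1)[OF assms(1)] k] nested_ball_Int_Pow[OF assms(1) k]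
    by (simp add: nested_sphere_def Un_commute)
  ultimately show ?thesis
    unfolding minimal_nh_ball_def using d(2) by blast
qed

section \<open>Subdivisions preserve the dimension\<close>

text \<open>Gaussian elimination: if \<open>M w b\<close> is nonzero, \<open>w\<close> is a pivot.
  Subtracting multiples of its row clears the column \<open>b\<close> and leaves one vector and one
  condition fewer.\<close>

lemma ex_nontrivial_linear_relation:
  fixes M :: "'u \<Rightarrow> 'b \<Rightarrow> real"
  assumes "finite B" "finite A" "card B < card A"
  shows "\<exists>c. (\<exists>u\<in>A. c u \<noteq> 0) \<and> (\<forall>b\<in>B. (\<Sum>u\<in>A. c u * M u b) = 0)"
  using assms
proof (induction B arbitrary: A M rule: finite_induct)
  case empty
  then obtain u where "u \<in> A"
    by fastforce
  then show ?case
    by (intro exI[of _ "\<lambda>_. 1"]) auto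
next
  case (insert b B)
  show ?case
  proof (cases "\<forall>u\<in>A. M u b = 0")
    case True
    obtain c where "\<exists>u\<in>A. c u \<noteq> 0" "\<forall>b\<in>B. (\<Sum>u\<in>A. c u * M u b) = 0"
      using insert.IH[of A M] insert.prems insert.hyps by auto
    then show ?thesis
      using True by (intro exI[of _ c]) simp
  next
    case False
    then obtain w where w: "w \<in> A" "M w b \<noteq> 0" by blast
    let ?A = "A - {w}" and ?M = "\<lambda>u b'. M u b' - M u b / M w b * M w b'"
    have "card B < card ?A"
      using insert.prems insert.hyps w(1) by simp
    then obtain c where c: "\<exists>u\<in>?A. c u \<noteq> 0" "\<forall>b'\<in>B. (\<Sum>u\<in>?A. c u * ?M u b') = 0"
      using insert.IH[of ?A ?M] insert.prems by auto
    \<comment> \<open>The coefficient of \<open>w\<close> is the one that the condition at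
      \<open>b\<close> dictates; by the form of \<open>?M\<close> it satisfies the other conditions
      as well.\<close>
    let ?c = "c(w := - (\<Sum>u\<in>?A. c u * M u b) / M w b)"
    have split: "(\<Sum>u\<in>A. ?c u * M u b') = ?c w * M w b' + (\<Sum>u\<in>?A. c u * M u b')" for b'
      using insert.prems(1) w(1) by (subst sum.remove[of A w]) (auto intro!: sum.cong)
    have "(\<Sum>u\<in>A. ?c u * M u b') = 0" if "b' \<in> insert b B" for b'
    proof (cases "b' = b")
      case True
      then show ?thesis
        unfolding split using w(2) by simp
    next
      case False
      then have "0 = (\<Sum>u\<in>?A. c u * ?M u b')"
        using that c(2) by simp
      also have "\<dots> = (\<Sum>u\<in>?A. c u * M u b') - (\<Sum>u\<in>?A. c u * M u b * (M w b' / M w b))"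
        by (simp add: right_diff_distrib sum_subtractf mult.assoc)
      also have "(\<Sum>u\<in>?A. c u * M u b * (M w b' / M w b)) = (\<Sum>u\<in>?A. c u * M u b) * (M w b' / M w b)"
        by (simp only: sum_distrib_right)
      finally show ?thesis
        unfolding split by simp
    qed
    then show ?thesis
      using c(1) by (intro exI[of _ ?c]) auto
  qed
qed

lemma affine_ext_geom_simplex:
  assumes "fin_complex J" "\<sigma> \<in> J" "\<And>v. v \<notin> \<sigma> \<Longrightarrow> x v = 0"
  shows "affine_ext J p x a = (\<Sum>v\<in>\<sigma>. x v * p v a)"
  unfolding affine_ext_def
  using assms fin_complexD(4)[OF assms(1)] by (intro sum.mono_neutral_right) (auto simp: verts_def)

lemma subdividesE:
  assumes "subdivides J K"
  obtains p where "fin_complex J" "fin_complex K" "J = {} \<longleftrightarrow> K = {}"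
    "\<forall>\<sigma>\<in>J. \<exists>\<tau>\<in>K. p ` \<sigma> \<subseteq> geom_simplex \<tau>"
    "bij_betw (affine_ext J p) (realization J) (realization K)"
  using assms unfolding subdivides_def by metis

text \<open>If \<open>\<sigma>\<close> had more vertices than \<open>\<tau>\<close>, their
  placements would be linearly dependent. The coefficients sum to 0 because barycentric coordinates
  sum to 1, so shifting the barycentre of \<open>\<sigma>\<close> along the relation gives a second
  point with the same image, against injectivity.\<close>

lemma subdivides_card_le:
  assumes "subdivides J K" "\<sigma> \<in> J"
  shows "\<exists>\<tau>\<in>K. card \<sigma> \<le> card \<tau>"
proof -
  obtain p where J: "fin_complex J" and K: "fin_complex K" and JK: "J = {} \<longleftrightarrow> K = {}"
    and p: "\<forall>\<sigma>\<in>J. \<exists>\<tau>\<in>K. p ` \<sigma> \<subseteq> geom_simplex \<tau>"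
    and bij: "bij_betw (affine_ext J p) (realization J) (realization K)"
    using assms(1) by (rule subdividesE)
  obtain \<tau> where \<tau>: "\<tau> \<in> K" "p ` \<sigma> \<subseteq> geom_simplex \<tau>"
    using p assms(2) by blast
  have fin: "finite \<sigma>" "finite \<tau>"
    using fin_complexD(2)[OF J assms(2)] fin_complexD(2)[OF K \<tau>(1)] by auto
  have "card \<sigma> \<le> card \<tau>"
  proof (rule ccontr)
    assume "\<not> card \<sigma> \<le> card \<tau>"
    then obtain c where c: "\<exists>u\<in>\<sigma>. c u \<noteq> 0" "\<forall>b\<in>\<tau>. (\<Sum>u\<in>\<sigma>. c u * p u b) = 0"
      using ex_nontrivial_linear_relation[OF fin(2,1), of p] by auto
    have pu: "p u b = 0" if "u \<in> \<sigma>" "b \<notin> \<tau>" for u b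
      using \<tau>(2) that unfolding geom_simplex_def by auto
    have p1: "(\<Sum>b\<in>\<tau>. p u b) = 1" if "u \<in> \<sigma>" for u
      using \<tau>(2) that unfolding geom_simplex_def by auto
    have rel: "(\<Sum>u\<in>\<sigma>. c u * p u b) = 0" for b
      using c(2) pu by (cases "b \<in> \<tau>") auto
    have "(\<Sum>u\<in>\<sigma>. c u) = (\<Sum>u\<in>\<sigma>. \<Sum>b\<in>\<tau>. c u * p u b)"
      using p1 by (simp flip: sum_distrib_left)
    also have "\<dots> = (\<Sum>b\<in>\<tau>. \<Sum>u\<in>\<sigma>. c u * p u b)"
      by (rule sum.swap)
    finally have c0: "(\<Sum>u\<in>\<sigma>. c u) = 0"
      using rel by simp
    define n where "n = real (card \<sigma>)"
    have n: "0 < n"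
      using c(1) fin(1) unfolding n_def by (auto simp: card_gt_0_iff)
    define s where "s = (\<Sum>u\<in>\<sigma>. \<bar>c u\<bar>)"
    have s: "\<bar>c u\<bar> \<le> s" if "u \<in> \<sigma>" for u
      unfolding s_def using fin(1) that by (intro member_le_sum) auto
    have s0: "0 \<le> s"
      unfolding s_def by (intro sum_nonneg) auto
    let ?x = "\<lambda>u. if u \<in> \<sigma> then 1 / n else 0"
    \<comment> \<open>The divisor makes the shift at most \<open>1 / n\<close> in absolute value, so
      the coordinates stay nonnegative.\<close>
    let ?y = "\<lambda>u. if u \<in> \<sigma> then 1 / n + c u / (n * (1 + s)) else 0"
    have sum1: "(\<Sum>u\<in>\<sigma>. 1 / n) = 1"
      using n unfolding n_def by simp
    have "?x \<in> geom_simplex \<sigma>"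
      unfolding geom_simplex_def using n sum1 by simp
    moreover have "?y \<in> geom_simplex \<sigma>"
    proof -
      have "0 \<le> 1 / n + c u / (n * (1 + s))" if "u \<in> \<sigma>" for u
      proof -
        have "0 \<le> (1 + s) + c u"
          using s[OF that] by linarith
        then have "0 \<le> ((1 + s) + c u) / (n * (1 + s))"
          using n s0 by simp
        also have "((1 + s) + c u) / (n * (1 + s)) = 1 / n + c u / (n * (1 + s))"
          using n s0 by (simp add: add_divide_distrib[of "1 + s" "c u"])
        finally show ?thesis .
      qed
      moreover have "(\<Sum>u\<in>\<sigma>. 1 / n + c u / (n * (1 + s))) = 1"
        using sum1 c0 by (simp add: sum.distrib flip: sum_divide_distrib)
      ultimately show ?thesis
        unfolding geom_simplex_def by auto
    qed
    moreover have "affine_ext J p ?x = affine_ext J p ?y"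
    proof
      fix a
      have "affine_ext J p ?y a = (\<Sum>u\<in>\<sigma>. ?y u * p u a)"
        by (rule affine_ext_geom_simplex[OF J assms(2)]) simp
      also have "\<dots> = (\<Sum>u\<in>\<sigma>. ?x u * p u a + c u * p u a / (n * (1 + s)))"
        by (intro sum.cong) (auto simp: distrib_right)
      also have "\<dots> = (\<Sum>u\<in>\<sigma>. ?x u * p u a)"
        using rel[of a] by (simp add: sum.distrib flip: sum_divide_distrib)
      also have "\<dots> = affine_ext J p ?x a"
        by (rule affine_ext_geom_simplex[OF J assms(2), symmetric]) simp
      finally show "affine_ext J p ?x a = affine_ext J p ?y a" ..
    qed
    ultimately have eq: "?x = ?y"
      using bij assms(2) unfolding bij_betw_def realization_def by (auto dest: inj_onD)
    obtain u where "u \<in> \<sigma>" "c u \<noteq> 0"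
      using c(1) by blast
    then show False
      using fun_cong[OF eq, of u] n s0 by auto
  qed
  then show ?thesis
    using \<tau>(1) by blast
qed

text \<open>Finitely many proper subspaces do not cover a simplex: on the moment curve, each of them
  contains only finitely many points.\<close>

lemma card_le_subdivides:
  assumes "subdivides J K" "\<tau> \<in> K"
  shows "\<exists>\<sigma>\<in>J. card \<tau> \<le> card \<sigma>"
proof (rule ccontr)
  assume "\<not> (\<exists>\<sigma>\<in>J. card \<tau> \<le> card \<sigma>)"
  then have less: "card \<sigma> < card \<tau>" if "\<sigma> \<in> J" for \<sigma>
    using that by force
  obtain p where J: "fin_complex J" and K: "fin_complex K" and JK: "J = {} \<longleftrightarrow> K = {}"
    and p: "\<forall>\<sigma>\<in>J. \<exists>\<tau>\<in>K. p ` \<sigma> \<subseteq> geom_simplex \<tau>"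
    and bij: "bij_betw (affine_ext J p) (realization J) (realization K)"
    using assms(1) by (rule subdividesE)
  have fin: "finite \<tau>" "finite J"
    using fin_complexD(2)[OF K assms(2)] fin_complexD(1)[OF J] by auto
  have "J \<noteq> {}"
    using JK assms(2) by auto
  then have n: "0 < card \<tau>"
    using less by fastforce
  obtain i where i: "bij_betw i {0..<card \<tau>} \<tau>"
    using ex_bij_betw_nat_finite[OF fin(1)] by blast
  \<comment> \<open>A simplex with fewer vertices than \<open>\<tau>\<close> is placed in the kernel
    of a nonzero linear functional on the coordinates of \<open>\<tau>\<close>.\<close>
  have "\<exists>c. (\<exists>b\<in>\<tau>. c b \<noteq> 0) \<and> (\<forall>u\<in>\<sigma>. (\<Sum>b\<in>\<tau>. c b * p u b) = 0)" if "\<sigma> \<in> J" for \<sigma>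
    using ex_nontrivial_linear_relation[OF fin_complexD(2)[OF J that] fin(1) less[OF that],
        of "\<lambda>b u. p u b"] by simp
  then obtain c where c: "\<And>\<sigma>. \<sigma> \<in> J \<Longrightarrow> \<exists>b\<in>\<tau>. c \<sigma> b \<noteq> 0"
    "\<And>\<sigma> u. \<sigma> \<in> J \<Longrightarrow> u \<in> \<sigma> \<Longrightarrow> (\<Sum>b\<in>\<tau>. c \<sigma> b * p u b) = 0"
    by metis
  \<comment> \<open>The functional \<open>c \<sigma>\<close> evaluated at the point with coordinates
    \<open>t ^ j\<close>; dividing that point by \<open>s\<close> below puts it into the simplex
    \<open>\<tau>\<close>.\<close>
  let ?P = "\<lambda>\<sigma> t. \<Sum>j\<le>card \<tau> - 1. c \<sigma> (i j) * t ^ j :: real"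
  have range: "{..card \<tau> - 1} = {0..<card \<tau>}"
    using n by auto
  have roots: "finite {t. ?P \<sigma> t = 0}" if "\<sigma> \<in> J" for \<sigma>
  proof -
    obtain b where "b \<in> i ` {0..<card \<tau>}" "c \<sigma> b \<noteq> 0"
      using c(1)[OF \<open>\<sigma> \<in> J\<close>] bij_betw_imp_surj_on[OF i] by auto
    then obtain j where "j \<in> {0..<card \<tau>}" "c \<sigma> (i j) \<noteq> 0"
      by auto
    then show ?thesis
      by (subst polyfun_finite_roots) (auto intro!: exI[of _ j])
  qed
  have "infinite ({0<..} :: real set)"
    by (rule infinite_Ioi)
  then have "infinite ({0<..} - (\<Union>\<sigma>\<in>J. {t. ?P \<sigma> t = 0}))"
    using roots fin(2) by (intro Diff_infinite_finite) auto
  then have "{0<..} - (\<Union>\<sigma>\<in>J. {t. ?P \<sigma> t = 0}) \<noteq> {}"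
    by (rule infinite_imp_nonempty)
  then obtain t where t: "0 < t" "\<And>\<sigma>. \<sigma> \<in> J \<Longrightarrow> ?P \<sigma> t \<noteq> 0"
    by auto
  define s where "s = (\<Sum>j\<in>{0..<card \<tau>}. t ^ j)"
  have s: "0 < s"
    unfolding s_def using n t(1) by (intro sum_pos) auto
  let ?i = "inv_into {0..<card \<tau>} i"
  let ?y = "\<lambda>b. if b \<in> \<tau> then t ^ ?i b / s else 0"
  have reindex: "(\<Sum>b\<in>\<tau>. g b * t ^ ?i b) = (\<Sum>j\<in>{0..<card \<tau>}. g (i j) * t ^ j)" for g
    using i by (intro sum.reindex_bij_betw[OF i, symmetric, THEN trans] sum.cong)
      (auto simp: bij_betw_def inv_into_f_f)
  have "?y \<in> geom_simplex \<tau>"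
    unfolding geom_simplex_def
    using s t(1) reindex[of "\<lambda>_. 1"] by (auto simp: s_def simp flip: sum_divide_distrib)
  then have "?y \<in> affine_ext J p ` realization J"
    using bij assms(2) unfolding bij_betw_def realization_def by blast
  then obtain x \<sigma> where \<sigma>: "\<sigma> \<in> J" "x \<in> geom_simplex \<sigma>" "?y = affine_ext J p x"
    unfolding realization_def by auto
  have y: "?y b = (\<Sum>u\<in>\<sigma>. x u * p u b)" for b
  proof -
    have "affine_ext J p x b = (\<Sum>u\<in>\<sigma>. x u * p u b)"
      using \<sigma>(2) by (intro affine_ext_geom_simplex[OF J \<sigma>(1)]) (auto simp: geom_simplex_def)
    then show ?thesis
      using fun_cong[OF \<sigma>(3), of b] by simp
  qed
  have "(\<Sum>b\<in>\<tau>. c \<sigma> b * ?y b) = (\<Sum>b\<in>\<tau>. \<Sum>u\<in>\<sigma>. x u * (c \<sigma> b * p u b))"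
    unfolding y by (simp add: sum_distrib_left mult.left_commute)
  also have "\<dots> = (\<Sum>u\<in>\<sigma>. x u * (\<Sum>b\<in>\<tau>. c \<sigma> b * p u b))"
    by (subst sum.swap) (simp add: sum_distrib_left)
  also have "\<dots> = 0"
    using c(2)[OF \<sigma>(1)] by simp
  finally have "(\<Sum>b\<in>\<tau>. c \<sigma> b * t ^ ?i b) / s = 0"
    by (simp add: sum_divide_distrib)
  then have "?P \<sigma> t = 0"
    using s unfolding reindex range by simp
  then show False
    using t(2)[OF \<sigma>(1)] by simp
qed

text \<open>Cardinalities of simplices are compared through the common subdivision \<open>J\<close>,
  in both directions.\<close>

lemma has_dim_combinatorial_ball:
  assumes "combinatorial_ball k L"
  shows "has_dim L k"
proof -
  obtain J :: "nat set set" where J: "subdivides J L" "subdivides J (Pow {0..k})"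
    using assms unfolding combinatorial_ball_def by blast
  have le: "card \<tau> \<le> Suc k" if "\<tau> \<in> L" for \<tau>
  proof -
    obtain \<sigma> where \<sigma>: "\<sigma> \<in> J" "card \<tau> \<le> card \<sigma>"
      using card_le_subdivides[OF J(1) \<open>\<tau> \<in> L\<close>] by blast
    obtain \<rho> where "\<rho> \<subseteq> {0..k}" "card \<sigma> \<le> card \<rho>"
      using subdivides_card_le[OF J(2) \<sigma>(1)] by blast
    then show ?thesis
      using \<sigma>(2) card_mono[of "{0..k}" \<rho>] by simp
  qed
  obtain \<sigma> where \<sigma>: "\<sigma> \<in> J" "card {0..k} \<le> card \<sigma>"
    using card_le_subdivides[OF J(2), of "{0..k}"] by blast
  obtain \<tau> where "\<tau> \<in> L" "card \<sigma> \<le> card \<tau>"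
    using subdivides_card_le[OF J(1) \<sigma>(1)] by blast
  then have "\<tau> \<in> L" "card \<tau> = Suc k"
    using \<sigma>(2) le[of \<tau>] by auto
  then show ?thesis
    unfolding has_dim_def using le by blast
qed

section \<open>A collapsible complex does not retract onto the boundary of a simplex\<close>

lemma geom_simplex_bounds:
  assumes "x \<in> geom_simplex \<sigma>" "finite \<sigma>"
  shows "0 \<le> x v" "x v \<le> 1"
proof -
  show "0 \<le> x v"
    using assms(1) by (simp add: geom_simplex_def)
  have "x v \<le> sum x \<sigma>" if "v \<in> \<sigma>"
    using assms that by (intro member_le_sum) (auto simp: geom_simplex_def)
  then show "x v \<le> 1"
    using assms(1) by (cases "v \<in> \<sigma>") (auto simp: geom_simplex_def)
qed

lemma geom_simplex_mono:
  assumes "x \<in> geom_simplex \<sigma>" "\<sigma> \<subseteq> \<rho>" "finite \<rho>"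
  shows "x \<in> geom_simplex \<rho>"
proof -
  have "sum x \<rho> = sum x \<sigma>"
    using assms by (intro sum.mono_neutral_right) (auto simp: geom_simplex_def)
  then show ?thesis
    using assms unfolding geom_simplex_def by auto
qed

lemma geom_simplex_Diff:
  assumes "x \<in> geom_simplex \<sigma>" "finite \<sigma>" "x v = 0"
  shows "x \<in> geom_simplex (\<sigma> - {v})"
proof -
  have "sum x (\<sigma> - {v}) = sum x \<sigma>"
    using assms by (intro sum.mono_neutral_left) auto
  then show ?thesis
    using assms unfolding geom_simplex_def by auto
qed

lemma continuous_on_coordinate [continuous_intros]:
  "continuous_on S (\<lambda>x :: 'a \<Rightarrow> real. x i)"
  by (rule continuous_on_product_then_coordinatewise[OF continuous_on_id])

lemma continuous_on_coordinate_snd [continuous_intros]: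
  "continuous_on S (\<lambda>z :: 'b::topological_space \<times> ('a \<Rightarrow> real). snd z i)"
  by (rule continuous_on_product_then_coordinatewise[OF continuous_on_snd[OF continuous_on_id]])

lemma continuous_on_Min:
  fixes f :: "'i \<Rightarrow> 'a::topological_space \<Rightarrow> real"
  assumes "finite T" "T \<noteq> {}" "\<And>i. i \<in> T \<Longrightarrow> continuous_on S (f i)"
  shows "continuous_on S (\<lambda>x. Min ((\<lambda>i. f i x) ` T))"
  using assms
proof (induction T rule: finite_ne_induct)
  case (insert i T)
  then have "continuous_on S (\<lambda>x. min (f i x) (Min ((\<lambda>i. f i x) ` T)))"
    by (intro continuous_on_min) auto
  then show ?case
    using insert.hyps by simp
qed simp

lemma closed_hyperplane_sum: "closed {x :: 'a \<Rightarrow> real. (\<Sum>v\<in>\<sigma>. x v) = 1}"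
  by (intro closed_Collect_eq continuous_intros)

text \<open>A closed subset of a product of compact sets, with the coordinates outside
  \<open>\<sigma>\<close> confined to \<open>{0}\<close>. As the vertex type may be infinite, this
  rests on Tychonoff's theorem.\<close>

lemma compact_geom_simplex:
  assumes "finite \<sigma>"
  shows "compact (geom_simplex \<sigma>)"
proof -
  let ?I = "\<lambda>v. if v \<in> \<sigma> then {0..1} else {0::real}"
  have "compactin (product_topology (\<lambda>_. euclideanreal) UNIV) (PiE UNIV ?I)"
    unfolding compactin_PiE by simp
  then have "compact (PiE UNIV ?I)"
    by (simp add: euclidean_product_topology)
  then have "compact (PiE UNIV ?I \<inter> {x. (\<Sum>v\<in>\<sigma>. x v) = 1})"
    using closed_hyperplane_sum by (rule compact_Int_closed)
  also have "PiE UNIV ?I \<inter> {x. (\<Sum>v\<in>\<sigma>. x v) = 1} = geom_simplex \<sigma>"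
  proof (intro equalityI subsetI)
    fix x assume x: "x \<in> PiE UNIV ?I \<inter> {x. (\<Sum>v\<in>\<sigma>. x v) = 1}"
    have I: "x v \<in> ?I v" for v
      using IntD1[OF x] by (rule PiE_mem) simp
    have "0 \<le> x v" "v \<notin> \<sigma> \<Longrightarrow> x v = 0" for v
      using I[of v] by (auto split: if_splits)
    then show "x \<in> geom_simplex \<sigma>"
      using x unfolding geom_simplex_def by auto
  next
    fix x assume "x \<in> geom_simplex \<sigma>"
    then show "x \<in> PiE UNIV ?I \<inter> {x. (\<Sum>v\<in>\<sigma>. x v) = 1}"
      using geom_simplex_bounds[OF _ assms, of x] by (auto simp: geom_simplex_def)
  qed
  finally show ?thesis .
qed

lemma compact_realization: "fin_complex K \<Longrightarrow> compact (realization K)"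
  unfolding realization_def by (intro compact_UN compact_geom_simplex) (auto dest: fin_complexD)

section \<open>Contractibility of collapsible complexes\<close>

lemma fin_complex_elem_collapse:
  assumes "fin_complex K" "elem_collapse K K'"
  shows "fin_complex K'"
proof -
  obtain \<tau> \<sigma> where c: "\<tau> \<subset> \<sigma>" "\<forall>\<rho>\<in>K. \<tau> \<subset> \<rho> \<longrightarrow> \<rho> = \<sigma>" "K' = K - {\<tau>, \<sigma>}"
    using assms(2) unfolding elem_collapse_def by blast
  show ?thesis
    unfolding fin_complex_def
  proof (intro conjI ballI allI impI)
    fix \<rho> \<eta> assume \<rho>: "\<rho> \<in> K'" "\<eta> \<subseteq> \<rho>"
    then have "\<not> \<tau> \<subset> \<rho>" "\<rho> \<noteq> \<tau>"
      using c(2,3) by auto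
    then have "\<eta> \<noteq> \<tau>" "\<eta> \<noteq> \<sigma>"
      using \<rho>(2) c(1) by auto
    then show "\<eta> \<in> K'"
      using \<rho> fin_complexD(3)[OF assms(1), of \<rho> \<eta>] unfolding c(3) by simp
  qed (use fin_complexD(1,2)[OF assms(1)] c(3) in auto)
qed

text \<open>Subtracting from the coordinates of the free face their minimum, and adding the difference to
  the opposite vertex, pushes the simplex onto the faces that survive the collapse.\<close>

lemma contractible_elem_collapse:
  assumes K: "fin_complex K" and "elem_collapse K K'" and contr: "contractible (realization K')"
  shows "contractible (realization K)"
proof -
  obtain \<tau> \<sigma> where c: "\<tau> \<in> K" "\<sigma> \<in> K" "\<tau> \<noteq> {}" "\<tau> \<subset> \<sigma>" "\<forall>\<rho>\<in>K. \<tau> \<subset> \<rho> \<longrightarrow> \<rho> = \<sigma>"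
    "K' = K - {\<tau>, \<sigma>}"
    using assms(2) unfolding elem_collapse_def by blast
  obtain w where w: "w \<in> \<sigma>" "w \<notin> \<tau>"
    using c(4) by blast
  \<comment> \<open>The only proper coface of \<open>\<tau>\<close> must be
    \<open>insert w \<tau>\<close>, so the free face has codimension one.\<close>
  have "insert w \<tau> \<in> K"
    using c(4) w by (intro fin_complexD(3)[OF K c(2)]) auto
  then have \<sigma>: "\<sigma> = insert w \<tau>"
    using c(5) w(2) by auto
  have fin: "finite \<tau>" "finite \<sigma>"
    using fin_complexD(2)[OF K] c(1,2) by auto
  define m where "m = (\<lambda>x :: 'a \<Rightarrow> real. Min ((\<lambda>v. x v) ` \<tau>))"
  \<comment> \<open>The factor \<open>card \<tau>\<close> at \<open>w\<close> compensates the equal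
    amounts taken from all coordinates in \<open>\<tau>\<close>, so their sum stays 1.\<close>
  define H where "H = (\<lambda>(z :: real \<times> ('a \<Rightarrow> real)) a. snd z a
    - fst z * m (snd z) * (if a \<in> \<tau> then 1 else 0)
    + fst z * m (snd z) * (if a = w then real (card \<tau>) else 0))"
  have m_le: "m x \<le> x v" if "v \<in> \<tau>" for x v
    unfolding m_def using fin(1) that by (intro Min_le) auto
  have m_in: "\<exists>v\<in>\<tau>. x v = m x" for x
  proof -
    have "m x \<in> (\<lambda>v. x v) ` \<tau>"
      unfolding m_def using fin(1) c(3) by (intro Min_in) auto
    then show ?thesis by auto
  qed
  have contH: "continuous_on S H" for S
  proof -
    have "continuous_on S (\<lambda>z :: real \<times> ('a \<Rightarrow> real). m (snd z))"
      unfolding m_def using fin(1) c(3) by (intro continuous_on_Min continuous_intros) auto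
    then show ?thesis
      unfolding H_def by (intro continuous_intros)
  qed
  have stay: "H (s, x) \<in> realization K" if s: "0 \<le> s" "s \<le> 1" and x: "x \<in> realization K" for s x
  proof -
    obtain \<rho> where \<rho>: "\<rho> \<in> K" "x \<in> geom_simplex \<rho>"
      using x unfolding realization_def by blast
    have nonneg: "0 \<le> x v" for v
      using \<rho>(2) unfolding geom_simplex_def by blast
    have m0: "0 \<le> m x"
      using m_in[of x] nonneg by metis
    \<comment> \<open>A point with \<open>m x = 0\<close> does not move. Otherwise its simplex
      contains \<open>\<tau>\<close>, and so the motion takes place inside
      \<open>\<sigma>\<close>.\<close>
    show ?thesis
    proof (cases "m x = 0")
      case True
      then have "H (s, x) = x"
        unfolding H_def by auto
      then show ?thesis using x by simp
    next
      case False
      have "v \<in> \<rho>" if "v \<in> \<tau>" for v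
        using m_le[OF that, of x] False m0 \<rho>(2) unfolding geom_simplex_def by force
      then have "\<rho> \<subseteq> \<sigma>"
        using c(4,5) \<rho>(1) by (metis order_refl psubsetE psubsetI subsetI)
      then have x\<sigma>: "x \<in> geom_simplex \<sigma>"
        using geom_simplex_mono[OF \<rho>(2) _ fin(2)] by blast
      have sm: "s * m x \<le> m x"
        using m0 s mult_left_le_one_le[of "m x" s] by simp
      have "0 \<le> H (s, x) a" for a
      proof (cases "a \<in> \<tau>")
        case True
        then have "a \<noteq> w" using w(2) by auto
        then show ?thesis
          unfolding H_def using True sm m_le[OF True, of x] by simp
      next
        case False
        then show ?thesis
          unfolding H_def using nonneg[of a] s(1) m0 by simp
      qed
      moreover have "H (s, x) a = 0" if "a \<notin> \<sigma>" for a
        using that x\<sigma> unfolding H_def \<sigma> geom_simplex_def by auto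
      moreover have "(\<Sum>a\<in>\<sigma>. H (s, x) a) = 1"
      proof -
        have "(\<Sum>a\<in>\<sigma>. H (s, x) a) = H (s, x) w + (\<Sum>a\<in>\<tau>. H (s, x) a)"
          unfolding \<sigma> using fin(1) w(2) by simp
        also have "H (s, x) w = x w + s * m x * real (card \<tau>)"
          unfolding H_def using w(2) by simp
        also have "(\<Sum>a\<in>\<tau>. H (s, x) a) = (\<Sum>a\<in>\<tau>. x a - s * m x)"
          unfolding H_def using w(2) by (intro sum.cong) auto
        also have "\<dots> = (\<Sum>a\<in>\<tau>. x a) - real (card \<tau>) * (s * m x)"
          by (simp add: sum_subtractf)
        finally have "(\<Sum>a\<in>\<sigma>. H (s, x) a) = x w + (\<Sum>a\<in>\<tau>. x a)"
          by simp
        also have "\<dots> = (\<Sum>a\<in>\<sigma>. x a)"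
          unfolding \<sigma> using fin(1) w(2) by simp
        finally show ?thesis
          using x\<sigma> unfolding geom_simplex_def by simp
      qed
      ultimately have "H (s, x) \<in> geom_simplex \<sigma>"
        unfolding geom_simplex_def by blast
      then show ?thesis
        using c(2) unfolding realization_def by blast
    qed
  qed
  let ?r = "\<lambda>x. H (1, x)"
  have r: "?r x \<in> realization K'" if x: "x \<in> realization K" for x
  proof -
    obtain \<rho> where \<rho>: "\<rho> \<in> K" "?r x \<in> geom_simplex \<rho>"
      using stay[OF _ _ x, of 1] unfolding realization_def by auto
    \<comment> \<open>At time 1 the smallest coordinate vanishes. A simplex without \<open>v\<close>
      is neither \<open>\<tau>\<close> nor \<open>\<sigma>\<close>, so it survives the
      collapse.\<close>
    obtain v where v: "v \<in> \<tau>" "x v = m x"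
      using m_in by blast
    then have "?r x v = 0"
      unfolding H_def using w(2) by auto
    then have "?r x \<in> geom_simplex (\<rho> - {v})"
      using geom_simplex_Diff[OF \<rho>(2) fin_complexD(2)[OF K \<rho>(1)]] by blast
    moreover have "\<rho> - {v} \<in> K'"
      using fin_complexD(3)[OF K \<rho>(1), of "\<rho> - {v}"] v(1) c(4) unfolding c(6) by auto
    ultimately show ?thesis
      unfolding realization_def by blast
  qed
  have cont_r: "continuous_on (realization K) ?r"
    by (rule continuous_on_compose2[OF contH[of UNIV]]) (auto intro!: continuous_intros)
  have sub: "realization K' \<subseteq> realization K"
    unfolding realization_def c(6) by blast
  \<comment> \<open>\<open>H\<close> joins the identity to \<open>?r\<close>, and \<open>?r\<close>
    factors through the contractible realization of \<open>K'\<close>.\<close>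
  have "homotopic_with_canon (\<lambda>_. True) (realization K) (realization K) id ?r"
    unfolding homotopic_with_def
  proof (intro exI[of _ H] conjI allI ballI)
    show "continuous_map (prod_topology (top_of_set {0..1}) (top_of_set (realization K)))
        (top_of_set (realization K)) H"
      using stay contH by (auto simp: image_subset_iff)
    show "H (0, x) = id x" for x
      unfolding H_def by auto
  qed auto
  moreover obtain b where
    "homotopic_with_canon (\<lambda>_. True) (realization K) (realization K) (id \<circ> ?r) (\<lambda>x. b)"
  proof (rule nullhomotopic_through_contractible[OF cont_r _ _ _ contr])
    show "?r \<in> realization K \<rightarrow> realization K'"
      using r by (rule Pi_I)
    show "continuous_on (realization K') id"
      by (rule continuous_on_id')
    show "id \<in> realization K' \<rightarrow> realization K"
      using sub by auto
  qed (rule that)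
  ultimately have "homotopic_with_canon (\<lambda>_. True) (realization K) (realization K) id (\<lambda>x. b)"
    unfolding id_comp by (rule homotopic_with_trans)
  then show ?thesis
    unfolding contractible_def by (rule exI[of _ b])
qed

lemma contractible_collapses:
  assumes "elem_collapse\<^sup>*\<^sup>* J {{}, {v}}" "fin_complex J"
  shows "contractible (realization J)"
  using assms
proof (induction rule: converse_rtranclp_induct)
  case base
  have "geom_simplex {v} = {\<lambda>b. if b = v then 1 else 0}"
    unfolding geom_simplex_def by (auto simp: fun_eq_iff)
  moreover have "geom_simplex ({} :: 'a set) = {}"
    unfolding geom_simplex_def by simp
  ultimately have "realization {{}, {v}} = {\<lambda>b. if b = v then 1 else 0}"
    unfolding realization_def by simp
  then show ?case
    unfolding contractible_space_top_of_set[symmetric] by simp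
next
  case (step K K')
  then show ?case
    using contractible_elem_collapse fin_complex_elem_collapse by blast
qed

lemma continuous_on_affine_ext: "continuous_on S (affine_ext J p)"
  unfolding affine_ext_def by (intro continuous_intros)

text \<open>The affine extension is a continuous bijection from a compact space onto a Hausdorff
  space, hence a homeomorphism from the subdivision to \<open>B\<close>.\<close>

lemma contractible_realization_collapsible:
  assumes "collapsible B"
  shows "contractible (realization B)"
proof -
  obtain J :: "nat set set" and v where J: "subdivides J B" "elem_collapse\<^sup>*\<^sup>* J {{}, {v}}"
    using assms unfolding collapsible_def by blast
  obtain p where p: "fin_complex J" "bij_betw (affine_ext J p) (realization J) (realization B)"
    using J(1) by (rule subdividesE)
  let ?X = "top_of_set (realization J)" and ?Y = "top_of_set (realization B)"
  have "homeomorphic_map ?X ?Y (affine_ext J p)"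
  proof (rule continuous_imp_homeomorphic_map)
    show "continuous_map ?X ?Y (affine_ext J p)"
      using p(2) continuous_on_affine_ext by (auto simp: bij_betw_def)
    show "compact_space ?X"
      using compact_realization[OF p(1)] by (simp add: compact_space_subtopology)
    show "Hausdorff_space ?Y"
      unfolding euclidean_product_topology[symmetric]
      by (intro Hausdorff_space_subtopology) (simp add: Hausdorff_space_product_topology)
  qed (use p(2) in \<open>auto simp: bij_betw_def\<close>)
  then have "?X homeomorphic_space ?Y"
    using homeomorphic_map_imp_homeomorphic_space by blast
  then show ?thesis
    using contractible_collapses[OF J(2) p(1)] homeomorphic_space_contractibility
    by (metis contractible_space_top_of_set)
qed

text \<open>Identifying the boundary of the simplex on \<open>Q\<close> with a sphere, the inclusion of the boundary
  followed by the retraction \<open>r\<close> is the identity of a noncontractible space.\<close>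

lemma not_collapsible_if_retracts:
  assumes B: "fin_complex B" and Q: "finite Q" "2 \<le> card Q" "Pow Q - {Q} \<subseteq> B"
    and rQ: "\<And>q. q \<in> Q \<Longrightarrow> r q = q" and r: "\<And>\<sigma>. \<sigma> \<in> B \<Longrightarrow> r ` \<sigma> \<subset> Q"
  shows "\<not> collapsible B"
proof
  assume "collapsible B"
  then have contr: "contractible (realization B)"
    by (rule contractible_realization_collapsible)
  \<comment> \<open>The boundary of a simplex with \<open>n + 2\<close> vertices is an
    \<open>n\<close>-sphere; two points give the sphere of dimension 0.\<close>
  define n where "n = card Q - 2"
  have card: "card Q = Suc (Suc n)"
    unfolding n_def using Q(2) by simp
  obtain e where "bij_betw e {0..<Suc (Suc n)} Q"
    using ex_bij_betw_nat_finite[OF Q(1)] card by auto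
  then have e: "bij_betw e {..Suc n} Q"
    by (simp add: atLeast0LessThan lessThan_Suc_atMost)
  define i where "i = inv_into {..Suc n} e"
  have ie: "i (e j) = j" if "j \<le> Suc n" for j
    unfolding i_def using e that by (auto simp: bij_betw_def inv_into_f_f)
  have ei: "e (i q) = q" "i q \<le> Suc n" if "q \<in> Q" for q
    unfolding i_def using e that inv_into_into[of q e "{..Suc n}"]
    by (auto simp: bij_betw_def f_inv_into_f)
  have eQ: "e j \<in> Q" if "j \<le> Suc n" for j
    using e that by (auto simp: bij_betw_def)
  have reindex: "(\<Sum>q\<in>Q. g q) = (\<Sum>j\<le>Suc n. g (e j))" for g :: "'a \<Rightarrow> real"
    by (rule sum.reindex_bij_betw[OF e, symmetric])
  have QB: "q \<in> verts B" if "q \<in> Q" for q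
  proof -
    have "{q} \<in> Pow Q - {Q}"
      using that card by auto
    then show ?thesis
      using Q(3) by (auto simp: verts_def)
  qed
  define S where "S = {x :: nat \<Rightarrow> real. (\<Sum>j\<le>n. (x j)\<^sup>2) = 1 \<and> (\<forall>j>n. x j = 0)}"
  \<comment> \<open>The sphere sits in the \<open>n + 2\<close> coordinates with the last one equal
    to 0. Subtracting the minimum and dividing by the sum gives \<open>f\<close>, which maps it into
    the boundary of the simplex on \<open>Q\<close>.\<close>
  define m where "m = (\<lambda>x :: nat \<Rightarrow> real. Min ((\<lambda>j. x j) ` {..Suc n}))"
  define s where "s = (\<lambda>x :: nat \<Rightarrow> real. \<Sum>j\<le>Suc n. x j - m x)"
  define f where "f = (\<lambda>x a. if a \<in> Q then (x (i a) - m x) / s x else 0)"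
  \<comment> \<open>\<open>R\<close> extends the vertex map \<open>r\<close> affinely. Subtracting
    the last coordinate in \<open>D\<close> undoes the shift by the minimum, and dividing by the
    norm \<open>N\<close> returns to the sphere.\<close>
  define R where "R = (\<lambda>(y :: 'a \<Rightarrow> real) j. \<Sum>a\<in>verts B. if r a = e j then y a else 0)"
  define D where "D = (\<lambda>y j. if j \<le> n then R y j - R y (Suc n) else 0)"
  define N where "N = (\<lambda>y. sqrt (\<Sum>j\<le>n. (D y j)\<^sup>2))"
  define g where "g = (\<lambda>y j. D y j / N y)"
  have m_le: "m x \<le> x j" if "j \<le> Suc n" for x j
    unfolding m_def using that by (intro Min_le) auto
  have s_pos: "0 < s x" if "x \<in> S" for x
  proof (rule ccontr)
    assume "\<not> 0 < s x"
    moreover have "0 \<le> s x"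
      unfolding s_def using m_le by (intro sum_nonneg) auto
    ultimately have "s x = 0" by simp
    \<comment> \<open>If \<open>s x = 0\<close>, all coordinates agree with the last one, which is
      0; but the zero vector is not on the sphere.\<close>
    then have eq: "x j = m x" if "j \<le> Suc n" for j
      unfolding s_def using m_le[of _ x] that by (subst (asm) sum_nonneg_eq_0_iff) auto
    moreover have "x (Suc n) = 0"
      using \<open>x \<in> S\<close> unfolding S_def by simp
    ultimately have "x j = 0" if "j \<le> n" for j
      using that by (metis le_SucI order_refl)
    then show False
      using \<open>x \<in> S\<close> unfolding S_def by simp
  qed
  have f_in: "\<exists>j\<le>Suc n. f x \<in> geom_simplex (Q - {e j})" if "x \<in> S" for x
  proof -
    have "m x \<in> (\<lambda>j. x j) ` {..Suc n}"
      unfolding m_def by (intro Min_in) auto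
    then obtain j where j: "j \<le> Suc n" "x j = m x"
      by auto
    have "0 \<le> f x a" for a
      unfolding f_def using m_le[OF ei(2)] s_pos[OF that] by simp
    moreover have "(\<Sum>q\<in>Q. f x q) = 1"
    proof -
      have "(\<Sum>q\<in>Q. f x q) = (\<Sum>k\<le>Suc n. (x k - m x) / s x)"
        unfolding reindex f_def using eQ ie by (intro sum.cong) auto
      also have "\<dots> = s x / s x"
        unfolding s_def by (simp only: sum_divide_distrib)
      finally show ?thesis
        using s_pos[OF that] by simp
    qed
    ultimately have "f x \<in> geom_simplex Q"
      unfolding geom_simplex_def by (simp add: f_def)
    moreover have "f x (e j) = 0"
      unfolding f_def using j ie by simp
    ultimately have "f x \<in> geom_simplex (Q - {e j})"
      using geom_simplex_Diff[OF _ Q(1)] by simp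
    then show ?thesis
      using j(1) by blast
  qed
  have f_B: "f x \<in> realization B" if "x \<in> S" for x
  proof -
    obtain j where j: "j \<le> Suc n" "f x \<in> geom_simplex (Q - {e j})"
      using f_in[OF \<open>x \<in> S\<close>] by blast
    have "Q - {e j} \<in> B"
      using Q(3) eQ[OF j(1)] by blast
    then show ?thesis
      using j(2) unfolding realization_def by blast
  qed
  have cont_f: "continuous_on S f"
  proof -
    have m: "continuous_on S m"
      unfolding m_def by (intro continuous_on_Min continuous_intros) auto
    then have "continuous_on S s"
      unfolding s_def by (intro continuous_intros)
    moreover have "\<forall>x\<in>S. s x \<noteq> 0"
      using s_pos by (simp add: less_imp_neq[symmetric])
    ultimately have "continuous_on S (\<lambda>x. (x (i a) - m x) / s x)" for a
      using m by (intro continuous_on_divide continuous_on_diff continuous_on_coordinate)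
    then have "continuous_on S (\<lambda>x. f x a)" for a
      unfolding f_def by (cases "a \<in> Q") simp_all
    then show ?thesis
      by (rule continuous_on_coordinatewise_then_product)
  qed
  have N_pos: "0 < N y" if "y \<in> realization B" for y
  proof -
    obtain \<sigma> where \<sigma>: "\<sigma> \<in> B" "y \<in> geom_simplex \<sigma>"
      using \<open>y \<in> realization B\<close> unfolding realization_def by blast
    have y0: "y a = 0" if "a \<notin> \<sigma>" for a
      using \<sigma>(2) that unfolding geom_simplex_def by blast
    have \<sigma>V: "\<sigma> \<subseteq> verts B"
      using \<sigma>(1) by (auto simp: verts_def)
    \<comment> \<open>If all differences vanished, the coordinates of \<open>R y\<close> would be
      equal. One of them is 0 because \<open>r\<close> misses a point of \<open>Q\<close> on the
      simplex, whereas their sum is 1.\<close>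
    have "\<exists>j\<le>n. D y j \<noteq> 0"
    proof (rule ccontr)
      assume "\<not> (\<exists>j\<le>n. D y j \<noteq> 0)"
      then have eq: "R y j = R y (Suc n)" if "j \<le> Suc n" for j
        using that unfolding D_def by (cases "j = Suc n") auto
      obtain q where q: "q \<in> Q" "q \<notin> r ` \<sigma>"
        using r[OF \<sigma>(1)] by blast
      have "R y (i q) = 0"
        unfolding R_def using q(2) y0 ei(1)[OF q(1)] by (intro sum.neutral) auto
      then have R0: "R y j = 0" if "j \<le> Suc n" for j
        using eq[OF that] eq[OF ei(2)[OF q(1)]] by simp
      have rV: "r a \<in> Q" if "a \<in> verts B" for a
        using r that unfolding verts_def by blast
      have "(\<Sum>j\<le>Suc n. R y j) = (\<Sum>a\<in>verts B. \<Sum>j\<le>Suc n. if r a = e j then y a else 0)"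
        unfolding R_def by (rule sum.swap)
      also have "\<dots> = (\<Sum>a\<in>verts B. \<Sum>q\<in>Q. if r a = q then y a else 0)"
        unfolding reindex ..
      also have "\<dots> = (\<Sum>a\<in>verts B. y a)"
        using rV Q(1) by (intro sum.cong) (auto simp: sum.delta)
      also have "\<dots> = (\<Sum>a\<in>\<sigma>. y a)"
        using y0 \<sigma>V fin_complexD(4)[OF B] by (intro sum.mono_neutral_right) auto
      also have "\<dots> = 1"
        using \<sigma>(2) unfolding geom_simplex_def by blast
      finally show False
        using R0 by simp
    qed
    then obtain j where "j \<le> n" "D y j \<noteq> 0" by blast
    then have "0 < (\<Sum>j\<le>n. (D y j)\<^sup>2)"
      by (intro sum_pos2[of _ j]) auto
    then show ?thesis
      unfolding N_def by simp
  qed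
  have g_S: "g y \<in> S" if "y \<in> realization B" for y
  proof -
    have "(\<Sum>j\<le>n. (g y j)\<^sup>2) = (\<Sum>j\<le>n. (D y j)\<^sup>2) / (N y)\<^sup>2"
      unfolding g_def by (simp add: power_divide sum_divide_distrib)
    also have "(\<Sum>j\<le>n. (D y j)\<^sup>2) = (N y)\<^sup>2"
      unfolding N_def by (simp add: sum_nonneg)
    finally show ?thesis
      unfolding S_def using N_pos[OF that] by (simp add: g_def D_def)
  qed
  have cont_g: "continuous_on (realization B) g"
  proof -
    have D: "continuous_on (realization B) (\<lambda>y. D y j)" for j
    proof -
      have "continuous_on (realization B) (\<lambda>y. R y j)" for j
        unfolding R_def
      proof (intro continuous_on_sum)
        fix a
        show "continuous_on (realization B) (\<lambda>y. if r a = e j then y a else 0)"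
          by (cases "r a = e j") (simp_all add: continuous_on_coordinate)
      qed
      then show ?thesis
        unfolding D_def by (cases "j \<le> n") (simp_all add: continuous_on_diff)
    qed
    then have "continuous_on (realization B) N"
      unfolding N_def by (intro continuous_intros)
    moreover have "\<forall>y\<in>realization B. N y \<noteq> 0"
      using N_pos by (simp add: less_imp_neq[symmetric])
    ultimately have "continuous_on (realization B) (\<lambda>y. g y j)" for j
      unfolding g_def using D by (intro continuous_on_divide)
    then show ?thesis
      by (rule continuous_on_coordinatewise_then_product)
  qed
  have gf: "g (f x) = x" if "x \<in> S" for x
  proof -
    have R: "R (f x) j = (x j - m x) / s x" if "j \<le> Suc n" for j
    proof -
      have "R (f x) j = (\<Sum>a\<in>verts B. if a = e j then f x a else 0)"
        unfolding R_def using rQ eQ[OF that] by (intro sum.cong) (auto simp: f_def)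
      also have "\<dots> = f x (e j)"
        using QB[OF eQ[OF that]] fin_complexD(4)[OF B] by simp
      finally show ?thesis
        unfolding f_def using eQ[OF that] ie[OF that] by simp
    qed
    have "x (Suc n) = 0"
      using that unfolding S_def by simp
    then have D: "D (f x) j = x j / s x" for j
      using that unfolding D_def S_def
      by (cases "j \<le> n") (auto simp: R diff_divide_distrib)
    have "(\<Sum>j\<le>n. (D (f x) j)\<^sup>2) = (\<Sum>j\<le>n. (x j)\<^sup>2) / (s x)\<^sup>2"
      unfolding D by (simp add: power_divide sum_divide_distrib)
    also have "\<dots> = (1 / s x)\<^sup>2"
      using that unfolding S_def by (simp add: power_divide)
    finally have "N (f x) = 1 / s x"
      unfolding N_def using s_pos[OF that] by simp
    then show ?thesis
      unfolding g_def D using s_pos[OF that] by auto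
  qed
  obtain b where b: "homotopic_with_canon (\<lambda>_. True) S S (g \<circ> f) (\<lambda>x. b)"
  proof (rule nullhomotopic_through_contractible[OF cont_f _ cont_g _ contr])
    show "f \<in> S \<rightarrow> realization B"
      using f_B by (rule Pi_I)
    show "g \<in> realization B \<rightarrow> S"
      using g_S by (rule Pi_I)
  qed (rule that)
  have "homotopic_with_canon (\<lambda>_. True) S S id (g \<circ> f)"
    using gf by (intro homotopic_with_equal) auto
  then have "homotopic_with_canon (\<lambda>_. True) S S id (\<lambda>x. b)"
    using b by (rule homotopic_with_trans)
  then have "contractible S"
    unfolding contractible_def by (rule exI[of _ b])
  moreover have "nsphere n = top_of_set S"
    unfolding nsphere S_def euclidean_product_topology ..
  ultimately show False
    using non_contractible_space_nsphere[of n] by simp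
qed

section \<open>Minimal NH-spheres and NH-balls are nested\<close>

lemma nh_manifold_link_vertex:
  assumes "nh_manifold d M" "v \<in> verts M"
  shows "nh_ball_or_sphere (link {v} M)"
  using assms(1)
proof (cases rule: nh_manifold.cases)
  case manifold_0
  have "\<tau> = {}" if "\<tau> \<in> link {v} M" for \<tau>
  proof -
    have "\<tau> \<union> {v} \<in> M" "\<tau> \<inter> {v} = {}"
      using that by (auto simp: link_def)
    then have "card (insert v \<tau>) \<le> 1" "v \<notin> \<tau>" "finite \<tau>"
      using manifold_0(3) fin_complexD(2)[OF manifold_0(2), of "insert v \<tau>"]
      unfolding has_dim_def by auto
    then show ?thesis by auto
  qed
  moreover have "{v} \<in> M"
    using assms(2) in_verts_iff[OF manifold_0(2)] by blast
  then have "{} \<in> link {v} M"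
    using fin_complexD(3)[OF manifold_0(2), of "{v}" "{}"] by (auto simp: link_def)
  ultimately have "link {v} M = {{}}"
    by blast
  then show ?thesis
    unfolding nh_ball_or_sphere_def using nh_manifold_nh_ball_nh_sphere.sphere_minus_1 by metis
next
  case manifold
  then show ?thesis
    unfolding nh_ball_or_sphere_def using assms(2) by blast
qed

lemma link_insert:
  assumes "fin_complex M" "v \<notin> \<sigma>"
  shows "link (insert v \<sigma>) M = link \<sigma> (link {v} M)"
proof (intro equalityI subsetI)
  fix \<tau> assume "\<tau> \<in> link (insert v \<sigma>) M"
  then have "\<tau> \<inter> insert v \<sigma> = {}" and \<tau>: "\<tau> \<union> insert v \<sigma> \<in> M"
    by (auto simp: link_def)
  moreover have "\<tau> \<in> M" "insert v \<tau> \<in> M" "\<tau> \<union> \<sigma> \<in> M"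
    by (rule fin_complexD(3)[OF assms(1) \<tau>], blast)+
  ultimately show "\<tau> \<in> link \<sigma> (link {v} M)"
    unfolding link_def using assms(2) by simp
next
  fix \<tau> assume "\<tau> \<in> link \<sigma> (link {v} M)"
  then show "\<tau> \<in> link (insert v \<sigma>) M"
    by (auto simp: link_def)
qed

text \<open>The link of a simplex is reached by taking vertex links one at a time. As long as
  vertices remain, the intermediate link is not \<open>{{}}\<close> and is again an
  NH-manifold.\<close>

lemma nh_manifold_link:
  assumes "nh_manifold d M" "\<sigma> \<in> M" "\<sigma> \<noteq> {}"
  shows "nh_ball_or_sphere (link \<sigma> M)"
  using assms
proof (induction "card \<sigma>" arbitrary: \<sigma> M d rule: less_induct)
  case less
  note M = nh_manifoldD(1)[OF less.prems(1)]
  obtain v where v: "v \<in> \<sigma>"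
    using less.prems(3) by blast
  have "v \<in> verts M"
    using v less.prems(2) by (auto simp: verts_def)
  then have lk: "nh_ball_or_sphere (link {v} M)"
    by (rule nh_manifold_link_vertex[OF less.prems(1)])
  let ?\<sigma> = "\<sigma> - {v}"
  have ins: "insert v ?\<sigma> = \<sigma>"
    using v by blast
  show ?case
  proof (cases "?\<sigma> = {}")
    case True
    then have "\<sigma> = {v}" using v by blast
    then show ?thesis using lk by simp
  next
    case False
    have mem: "?\<sigma> \<in> link {v} M"
      unfolding link_def using fin_complexD(3)[OF M less.prems(2), of ?\<sigma>] less.prems(2) ins by auto
    have "link {v} M \<noteq> {{}}"
      using mem False by (metis singletonD)
    then obtain d' where "nh_manifold d' (link {v} M)"
      using lk nh_ball_imp_manifold nh_sphere_imp_manifold unfolding nh_ball_or_sphere_def by metis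
    moreover have "card ?\<sigma> < card \<sigma>"
      using v fin_complexD(2)[OF M less.prems(2)] by (intro psubset_card_mono) auto
    ultimately have "nh_ball_or_sphere (link ?\<sigma> (link {v} M))"
      using less.hyps[OF _ _ mem False] by simp
    then show ?thesis
      using link_insert[OF M, of v ?\<sigma>] ins by simp
  qed
qed

text \<open>A \<open>k\<close>-simplex of \<open>L\<close> is too large for the boundary, which is
  all that \<open>L\<close> shares with \<open>B\<close>. A ridge of it lies either in a second
  \<open>k\<close>-simplex of \<open>L\<close>, or on the boundary and thus in a facet of
  \<open>B\<close>; that facet omits \<open>v\<close>, for otherwise \<open>F\<close> would be in
  \<open>B\<close>.\<close>

lemma nh_decomposition_top_simplex:
  assumes dec: "nh_decomposition d k S B L" and F: "F \<in> L" "card F = Suc k"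
  shows "F \<in> principal S" "F \<notin> B"
    "\<And>v. v \<in> F \<Longrightarrow> \<exists>G\<in>principal S. v \<notin> G \<and> F - {v} \<subseteq> G"
proof -
  have B: "fin_complex B" "principal B \<subseteq> principal S"
    and L: "fin_complex L" "principal L \<subseteq> principal S" and dim: "has_dim L k"
    and BL: "B \<inter> L = ball_boundary k L"
    using dec has_dim_combinatorial_ball unfolding nh_decomposition_def top_generated_def by blast+
  have top: "E \<in> principal S \<and> E \<notin> B" if E: "E \<in> L" "card E = Suc k" for E
  proof
    have "\<not> E \<subset> \<tau>" if "\<tau> \<in> L" for \<tau>
    proof
      assume "E \<subset> \<tau>"
      then have "card E < card \<tau>"
        using fin_complexD(2)[OF L(1) that] by (rule psubset_card_mono[rotated])
      moreover have "card \<tau> \<le> Suc k"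
        using dim that unfolding has_dim_def by blast
      ultimately show False
        using E(2) by simp
    qed
    then show "E \<in> principal S"
      using E(1) L(2) unfolding principal_def by blast
    show "E \<notin> B"
    proof
      assume "E \<in> B"
      then have "E \<in> ball_boundary k L"
        using E(1) BL by blast
      then obtain \<rho> where "\<rho> \<in> L" "E \<subseteq> \<rho>" "card \<rho> = k"
        unfolding ball_boundary_def by blast
      then show False
        using E(2) card_mono[OF fin_complexD(2)[OF L(1)], of \<rho> E] by simp
    qed
  qed
  then show "F \<in> principal S" "F \<notin> B"
    using F by auto
  fix v assume v: "v \<in> F"
  let ?\<rho> = "F - {v}"
  have \<rho>: "?\<rho> \<in> L" "card ?\<rho> = k"
    using fin_complexD(3)[OF L(1) F(1), of ?\<rho>] F(2) v by auto
  show "\<exists>G\<in>principal S. v \<notin> G \<and> ?\<rho> \<subseteq> G"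
  proof (cases "\<exists>!\<sigma>. \<sigma> \<in> L \<and> card \<sigma> = Suc k \<and> ?\<rho> \<subseteq> \<sigma>")
    case True
    then have "?\<rho> \<in> ball_boundary k L"
      unfolding ball_boundary_def using \<rho> by (intro CollectI bexI[of _ ?\<rho>] conjI) auto
    then have "?\<rho> \<in> B"
      using BL by blast
    then obtain G where G: "G \<in> principal B" "?\<rho> \<subseteq> G"
      using ex_principal_superset[OF B(1)] by blast
    have "v \<notin> G"
    proof
      assume "v \<in> G"
      then have "F \<subseteq> G"
        using G(2) by blast
      moreover have "G \<in> B"
        using G(1) by (simp add: principal_def)
      ultimately have "F \<in> B"
        using fin_complexD(3)[OF B(1)] by blast
      then show False
        using \<open>F \<notin> B\<close> by simp
    qed
    moreover have "G \<in> principal S"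
      using G(1) B(2) by blast
    ultimately show ?thesis
      using G(2) by blast
  next
    case False
    then obtain \<sigma> where \<sigma>: "\<sigma> \<in> L" "card \<sigma> = Suc k" "?\<rho> \<subseteq> \<sigma>" "\<sigma> \<noteq> F"
      using F by (metis Diff_subset)
    have "v \<notin> \<sigma>"
    proof
      assume "v \<in> \<sigma>"
      then have "F \<subseteq> \<sigma>"
        using \<sigma>(3) by blast
      then have "F = \<sigma>"
        using F(2) \<sigma>(2) fin_complexD(2)[OF L(1) \<sigma>(1)] by (intro card_subset_eq) auto
      then show False
        using \<sigma>(4) by simp
    qed
    then show ?thesis
      using top[OF \<sigma>(1,2)] \<sigma>(3) by blast
  qed
qed

lemma nh_decomposition_ex_top_simplex:
  assumes "nh_decomposition d k S B L"
  shows "\<exists>F\<in>L. card F = Suc k"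
  using assms has_dim_combinatorial_ball unfolding nh_decomposition_def has_dim_def by blast

text \<open>Two disjoint simplices are disconnected, so they form a ball only in the degenerate
  point case, which nonempty \<open>P\<close> and \<open>Q\<close> exclude. In a sphere the piece
  \<open>L\<close> must be a point among them.\<close>

lemma disjoint_simplices_nh:
  assumes P: "finite P" "P \<noteq> {}" and Q: "finite Q" "Q \<noteq> {}" and disj: "P \<inter> Q = {}"
    and nh: "nh_ball_or_sphere (Pow P \<union> Pow Q)"
  shows "card P = 1 \<or> card Q = 1"
proof -
  let ?S = "Pow P \<union> Pow Q"
  consider (ball) k where "nh_ball k ?S" | (sphere) k h where "nh_sphere k h ?S"
    using nh unfolding nh_ball_or_sphere_def by blast
  then show ?thesis
  proof cases
    case ball
    then show ?thesis
    proof (cases rule: nh_ball.cases)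
      case (ball_0 v)
      have "P \<in> {{}, {v}}"
        unfolding ball_0(2)[symmetric] by simp
      then show ?thesis
        using P(2) by auto
    next
      case ball
      obtain p q where pq: "p \<in> P" "q \<in> Q"
        using P(2) Q(2) by blast
      have "p \<noteq> q"
        using pq disj by blast
      \<comment> \<open>The boundary of the simplex on \<open>{p, q}\<close> is a pair of points,
        onto which the two simplices retract.\<close>
      let ?r = "\<lambda>a. if a \<in> P then p else q"
      have "\<not> collapsible ?S"
      proof (rule not_collapsible_if_retracts)
        show "fin_complex ?S"
          by (intro fin_complex_Un fin_complex_Pow P(1) Q(1))
        show "2 \<le> card {p, q}"
          using \<open>p \<noteq> q\<close> by simp
        show "Pow {p, q} - {{p, q}} \<subseteq> ?S"
          using pq by (auto simp: Pow_insert)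
        show "?r a = a" if "a \<in> {p, q}" for a
          using that pq disj by auto
        show "?r ` \<sigma> \<subset> {p, q}" if "\<sigma> \<in> ?S" for \<sigma>
        proof -
          consider "\<sigma> \<subseteq> P" | "\<sigma> \<subseteq> Q"
            using \<open>\<sigma> \<in> ?S\<close> by blast
          then show ?thesis
          proof cases
            case 1
            then have "?r ` \<sigma> \<subseteq> {p}" by auto
            then show ?thesis
              by (rule order.strict_trans1) (use \<open>p \<noteq> q\<close> in auto)
          next
            case 2
            then have "?r ` \<sigma> \<subseteq> {q}" using disj by auto
            then show ?thesis
              by (rule order.strict_trans1) (use \<open>p \<noteq> q\<close> in auto)
          qed
        qed
      qed simp
      then show ?thesis
        using ball by blast
    qed
  next
    case sphere
    then show ?thesis
    proof (cases rule: nh_sphere.cases)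
      case sphere_minus_1
      have "P \<in> {{}}"
        unfolding sphere_minus_1(3)[symmetric] by simp
      then show ?thesis
        using P(2) by simp
    next
      case (sphere_0 v w)
      have "P \<in> {{}, {v}, {w}}"
        unfolding sphere_0(3)[symmetric] by simp
      then show ?thesis
        using P(2) by auto
    next
      case (sphere d B k L)
      then have dec: "nh_decomposition d k ?S B L"
        unfolding nh_decomposition_def by blast
      obtain F where F: "F \<in> L" "card F = Suc k"
        using nh_decomposition_ex_top_simplex[OF dec] by blast
      note top = nh_decomposition_top_simplex[OF dec F]
      have PQ: "E = P \<or> E = Q" if "E \<in> principal ?S" for E
        using that unfolding principal_def by auto
      \<comment> \<open>\<open>F\<close> is \<open>P\<close> or \<open>Q\<close>. For
        \<open>k = 0\<close> it is a point; for larger \<open>k\<close> a nonempty ridge of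
        \<open>F\<close> would also lie in the other simplex, against disjointness.\<close>
      show ?thesis
      proof (cases "k = 0")
        case True
        then show ?thesis
          using PQ[OF top(1)] F(2) by auto
      next
        case False
        have "F \<noteq> {}"
          using F(2) by auto
        then obtain v where v: "v \<in> F" by blast
        then obtain G where G: "G \<in> principal ?S" "v \<notin> G" "F - {v} \<subseteq> G"
          using top(3) by blast
        have "F - {v} \<noteq> {}"
        proof
          assume "F - {v} = {}"
          then have "F = {v}" using v by blast
          then show False using F(2) False by simp
        qed
        moreover have "G \<noteq> F"
          using v G(2) by blast
        ultimately show ?thesis
          using PQ[OF top(1)] PQ[OF G(1)] G(3) disj by blast
      qed
    qed
  qed
qed

section \<open>The facets of a minimal NH-sphere\<close>

locale minimal_nh_decomposition =
  fixes d k :: nat and S B L :: "'a set set"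
  assumes d: "1 \<le> d" and manifold: "nh_manifold d S"
    and dec: "nh_decomposition d k S B L" and minimal: "num_principal S = k + 2"
begin

lemma complexes: "fin_complex S" "fin_complex B" "fin_complex L" "S = B \<union> L"
  using nh_manifoldD(1)[OF manifold] dec unfolding nh_decomposition_def top_generated_def by auto

text \<open>For \<open>1 \<le> d\<close> collapsibility is part of the definition of a ball.
  Dimension 0 has its own rule \<open>ball_0\<close> and is treated outside the locale.\<close>

lemma collapsible_B: "collapsible B"
proof -
  have "nh_ball d B"
    using dec unfolding nh_decomposition_def by blast
  then show ?thesis
    using d by (auto elim: nh_ball.cases)
qed

text \<open>Each of the \<open>k + 1\<close> ridges of a \<open>k\<close>-simplex \<open>F\<close> of \<open>L\<close> lies in a facet other than \<open>F\<close>, and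
  these facets are distinct. Minimality leaves no room for any further facet.\<close>

lemma ex_facets:
  "\<exists>F X. F \<in> L \<and> finite F \<and> card F = Suc k \<and> (\<forall>v\<in>F. X v \<noteq> {} \<and> finite (X v) \<and> X v \<inter> F = {}) \<and>
    principal S = insert F ((\<lambda>v. F - {v} \<union> X v) ` F)"
proof -
  obtain F where F: "F \<in> L" "card F = Suc k"
    using nh_decomposition_ex_top_simplex[OF dec] by blast
  note top = nh_decomposition_top_simplex[OF dec F]
  have finF: "finite F"
    using fin_complexD(2)[OF complexes(3) F(1)] .
  obtain G where G: "\<And>v. v \<in> F \<Longrightarrow> G v \<in> principal S" "\<And>v. v \<in> F \<Longrightarrow> v \<notin> G v"
    "\<And>v. v \<in> F \<Longrightarrow> F - {v} \<subseteq> G v"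
    using top(3) by metis
  have inj: "inj_on G F"
  proof (rule inj_onI)
    fix u v assume uv: "u \<in> F" "v \<in> F" "G u = G v"
    show "u = v"
      using G(2)[OF uv(2)] G(3)[OF uv(1)] uv by blast
  qed
  have "F \<notin> G ` F"
    using G(2) by blast
  then have "card (insert F (G ` F)) = card (principal S)"
    using finF F(2) minimal card_image[OF inj] by (simp add: num_principal_def)
  moreover have "finite (principal S)"
    using minimal unfolding num_principal_def by (metis add_2_eq_Suc' card.infinite nat.distinct(1))
  moreover have "insert F (G ` F) \<subseteq> principal S"
    using G(1) top(1) by blast
  ultimately have prin: "principal S = insert F (G ` F)"
    by (metis card_subset_eq)
  let ?X = "\<lambda>v. G v - F"
  have GX: "G v = F - {v} \<union> ?X v" if "v \<in> F" for v
    using G(2,3)[OF that] by blast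
  \<comment> \<open>Otherwise the facet \<open>G v\<close> would be a proper face of
    \<open>F\<close>.\<close>
  have "?X v \<noteq> {}" if v: "v \<in> F" for v
  proof
    assume "?X v = {}"
    then have "G v \<subset> F"
      using v G(2)[OF v] by blast
    moreover have "F \<in> S"
      using F(1) complexes(4) by blast
    ultimately show False
      using G(1)[OF v] unfolding principal_def by blast
  qed
  moreover have "finite (?X v)" if "v \<in> F" for v
    using G(1)[OF that] fin_complexD(2)[OF complexes(1)] unfolding principal_def by blast
  moreover have "G ` F = (\<lambda>v. F - {v} \<union> ?X v) ` F"
    using GX by (rule image_cong[OF refl])
  ultimately show ?thesis
    using F finF prin by (intro exI[of _ F] exI[of _ ?X]) auto
qed

context
  fixes F X
  assumes F: "F \<in> L" "finite F" "card F = Suc k"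
    and X: "\<And>v. v \<in> F \<Longrightarrow> X v \<noteq> {}" "\<And>v. v \<in> F \<Longrightarrow> finite (X v)" "\<And>v. v \<in> F \<Longrightarrow> X v \<inter> F = {}"
    and prin: "principal S = insert F ((\<lambda>v. F - {v} \<union> X v) ` F)"
begin

private abbreviation (input) "G v \<equiv> F - {v} \<union> X v"

lemma facet_in: "v \<in> F \<Longrightarrow> G v \<in> principal S" "v \<in> F \<Longrightarrow> G v \<in> S"
  using prin unfolding principal_def by auto

lemma exchange_sets_comparable:
  assumes uv: "u \<in> F" "v \<in> F" "x \<in> X u" "x \<in> X v"
  shows "X u \<subseteq> X v \<or> X v \<subseteq> X u"
proof (cases "u = v")
  case False
  define A C where "A = G u" and "C = G v"
  have AC: "A \<in> S" "C \<in> S" "finite A" "finite C"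
    using facet_in(2)[OF uv(1)] facet_in(2)[OF uv(2)] F(2) X(2)[OF uv(1)] X(2)[OF uv(2)]
    unfolding A_def C_def by auto
  have x: "x \<in> A \<inter> C" "x \<notin> F"
    using uv X(3)[OF uv(1)] unfolding A_def C_def by auto
  have u: "u \<in> C - A" and v: "v \<in> A - C"
    using uv(1,2) False X(3)[OF uv(1)] X(3)[OF uv(2)] unfolding A_def C_def by auto
  \<comment> \<open>Since \<open>x\<close> lies in \<open>A \<inter> C\<close>, the facet
    \<open>F\<close> does not contain it. It contains all of \<open>F\<close> except
    \<open>u\<close> and \<open>v\<close>, so the only exchange facets around it are
    \<open>A\<close> and \<open>C\<close>.\<close>
  have "link (A \<inter> C) S = Pow (A - C) \<union> Pow (C - A)"
  proof (intro equalityI subsetI)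
    fix \<tau> assume "\<tau> \<in> link (A \<inter> C) S"
    then have \<tau>: "\<tau> \<inter> (A \<inter> C) = {}" "\<tau> \<union> A \<inter> C \<in> S"
      unfolding link_def by auto
    obtain P where P: "P \<in> principal S" "\<tau> \<union> A \<inter> C \<subseteq> P"
      using ex_principal_superset[OF complexes(1) \<tau>(2)] by (elim bexE)
    have "P \<noteq> F"
      using P(2) x by blast
    then obtain w where w: "w \<in> F" "P = G w"
      using P(1) unfolding prin by auto
    have "w \<notin> P"
      using w X(3)[OF w(1)] by auto
    then have "w \<notin> A \<inter> C"
      using P(2) by blast
    then have "w = u \<or> w = v"
      using w(1) unfolding A_def C_def by blast
    then have "P = A \<or> P = C"
      unfolding w(2) A_def C_def by auto
    then show "\<tau> \<in> Pow (A - C) \<union> Pow (C - A)"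
      using P(2) \<tau>(1) by auto
  next
    fix \<tau> assume \<tau>: "\<tau> \<in> Pow (A - C) \<union> Pow (C - A)"
    then have "\<tau> \<inter> (A \<inter> C) = {}" by blast
    moreover have "\<tau> \<union> A \<inter> C \<subseteq> A \<or> \<tau> \<union> A \<inter> C \<subseteq> C"
      using \<tau> by blast
    then have "\<tau> \<union> A \<inter> C \<in> S"
      using fin_complexD(3)[OF complexes(1) AC(1)] fin_complexD(3)[OF complexes(1) AC(2)] by metis
    moreover from this have "\<tau> \<in> S"
      by (rule fin_complexD(3)[OF complexes(1)]) blast
    ultimately show "\<tau> \<in> link (A \<inter> C) S"
      unfolding link_def by simp
  qed
  moreover have "nh_ball_or_sphere (link (A \<inter> C) S)"
  proof (rule nh_manifold_link[OF manifold])
    show "A \<inter> C \<in> S"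
      by (rule fin_complexD(3)[OF complexes(1) AC(1)]) blast
  qed (use x in blast)
  ultimately have "nh_ball_or_sphere (Pow (A - C) \<union> Pow (C - A))"
    by simp
  then have "card (A - C) = 1 \<or> card (C - A) = 1"
    using AC(3,4) u v by (intro disjoint_simplices_nh) auto
  \<comment> \<open>The single vertex is the exchanged one, so the corresponding difference of
    exchange sets is empty.\<close>
  then have "A - C = {v} \<or> C - A = {u}"
    using u v by (metis card_1_singletonE singletonD)
  moreover have "X u - X v \<subseteq> A - C - {v}" "X v - X u \<subseteq> C - A - {u}"
    using X(3)[OF uv(1)] X(3)[OF uv(2)] uv(1,2) unfolding A_def C_def by auto
  ultimately show ?thesis
    by auto
qed simp

text \<open>If \<open>L\<close> has a second facet, its ridges supply a common point of all \<open>X v\<close>. Otherwise \<open>L\<close> is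
  the simplex \<open>F\<close>, and without a common point \<open>B\<close> would retract onto the boundary of \<open>F\<close>.\<close>

lemma exchange_sets_common_point: "\<exists>x. \<forall>v\<in>F. x \<in> X v"
proof (cases "\<exists>u\<in>F. G u \<in> L")
  case True
  then obtain u where u: "u \<in> F" "G u \<in> L" by blast
  \<comment> \<open>\<open>L\<close> has dimension \<open>k\<close>, so \<open>X u\<close> is a
    singleton and \<open>G u\<close> is a \<open>k\<close>-simplex of \<open>L\<close> in its own
    right, with a facet across each of its ridges.\<close>
  have cardG: "card (G u) = k + card (X u)"
    using F X(2,3)[OF u(1)] u(1) by (subst card_Un_disjoint) auto
  moreover have "card (G u) \<le> Suc k"
    using has_dim_combinatorial_ball[of k L] dec u(2) unfolding nh_decomposition_def has_dim_def by blast
  moreover have "0 < card (X u)"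
    using X(1,2)[OF u(1)] by (simp add: card_gt_0_iff)
  ultimately have "card (X u) = 1" "card (G u) = Suc k"
    by linarith+
  then obtain x where x: "X u = {x}"
    by (auto simp: card_1_singleton_iff)
  have xF: "x \<notin> F"
    using X(3)[OF u(1)] x by blast
  \<comment> \<open>The ridge \<open>G u - {v}\<close> contains \<open>x\<close>, so the facet
    across it is not \<open>F\<close>. It omits \<open>v\<close>, so it is the facet for
    \<open>v\<close>, and \<open>x\<close> can only come from \<open>X v\<close>.\<close>
  have "x \<in> X v" if v: "v \<in> F" for v
  proof (cases "v = u")
    case False
    then have "v \<in> G u"
      using v by blast
    then obtain G' where G': "G' \<in> principal S" "v \<notin> G'" "G u - {v} \<subseteq> G'"
      using nh_decomposition_top_simplex(3)[OF dec u(2) \<open>card (G u) = Suc k\<close>] by blast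
    have xG': "x \<in> G'"
      using G'(3) x xF v by blast
    then obtain w where w: "w \<in> F" "G' = G w"
      using G'(1) xF unfolding prin by auto
    then have "w = v"
      using G'(2) v by blast
    then show ?thesis
      using xG' w xF by blast
  qed (simp add: x)
  then show ?thesis by blast
next
  case False
  then have GB: "G v \<in> B" if "v \<in> F" for v
    using facet_in(2)[OF that] that complexes(4) by blast
  \<comment> \<open>The retraction argument needs at least two vertices in \<open>F\<close>; for a
    single one any point of its exchange set is common.\<close>
  show ?thesis
  proof (cases "k = 0")
    case True
    then obtain v where "F = {v}"
      using F(3) by (auto simp: card_1_singleton_iff)
    then show ?thesis
      using X(1)[of v] by auto
  next
    case k: False
    show ?thesis
    proof (rule ccontr)
      assume "\<not> ?thesis"
      \<comment> \<open>\<open>s x\<close> is an index whose exchange set omits \<open>x\<close>;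
        the retraction sends each outer vertex there.\<close>
      then obtain s where s: "\<And>x. s x \<in> F" "\<And>x. x \<notin> X (s x)"
        by metis
      let ?r = "\<lambda>x. if x \<in> F then x else s x"
      have "\<not> collapsible B"
      proof (rule not_collapsible_if_retracts[OF complexes(2) F(2)])
        show "2 \<le> card F"
          using F(3) k by simp
        show "Pow F - {F} \<subseteq> B"
        proof
          fix \<sigma> assume "\<sigma> \<in> Pow F - {F}"
          then obtain v where v: "v \<in> F" "\<sigma> \<subseteq> F - {v}"
            by blast
          show "\<sigma> \<in> B"
            by (rule fin_complexD(3)[OF complexes(2) GB[OF v(1)]]) (use v(2) in blast)
        qed
        show "?r q = q" if "q \<in> F" for q
          using that by simp
        show "?r ` \<sigma> \<subset> F" if \<sigma>: "\<sigma> \<in> B" for \<sigma>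
        proof -
          obtain P where P: "P \<in> principal B" "\<sigma> \<subseteq> P"
            using ex_principal_superset[OF complexes(2) \<sigma>] by blast
          have "P \<in> principal S"
            using P(1) dec unfolding nh_decomposition_def top_generated_def by blast
          moreover have "P \<noteq> F"
            using P(1) nh_decomposition_top_simplex(2)[OF dec F(1,3)] by (auto simp: principal_def)
          ultimately obtain w where w: "w \<in> F" "P = G w"
            unfolding prin by blast
          \<comment> \<open>The facet for \<open>w\<close> is mapped away from \<open>w\<close>: a
            point of \<open>F\<close> in it differs from \<open>w\<close>, and for \<open>x\<close>
            in \<open>X w\<close> the index \<open>s x\<close> differs from
            \<open>w\<close>.\<close>
          have "?r x \<in> F - {w}" if "x \<in> \<sigma>" for x
          proof (cases "x \<in> F")
            case True
            then show ?thesis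
              using that P(2) w X(3)[OF w(1)] by auto
          next
            case False
            then have "x \<in> X w"
              using that P(2) w(2) by blast
            then show ?thesis
              using False s[of x] by auto
          qed
          then have "?r ` \<sigma> \<subseteq> F - {w}"
            by (rule image_subsetI)
          then show ?thesis
            by (rule order.strict_trans1) (use w(1) in auto)
        qed
      qed
      then show False
        using collapsible_B by simp
    qed
  qed
qed

lemma nested_F_X: "nested F X"
proof -
  obtain x where "\<forall>v\<in>F. x \<in> X v"
    using exchange_sets_common_point by blast
  then have "X u \<subseteq> X v \<or> X v \<subseteq> X u" if "u \<in> F" "v \<in> F" for u v
    using exchange_sets_comparable[OF that, of x] that by simp
  then show ?thesis
    unfolding nested_def using F(2) X by simp
qed

lemma S_eq_nested_sphere: "S = nested_sphere F X"
proof -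
  have "S = (\<Union>P\<in>principal S. Pow P)"
    by (rule Union_Pow_principal[OF complexes(1)])
  also have "\<dots> = nested_sphere F X"
    unfolding prin nested_sphere_def nested_ball_def by simp
  finally show ?thesis .
qed

text \<open>\<open>E\<close> indexes the facets that \<open>B\<close> leaves to \<open>L\<close>.
  Every facet of \<open>B\<close> exchanges an index outside \<open>E\<close> and so contains
  \<open>E\<close>, which therefore moves from \<open>F\<close> into the exchange sets.\<close>

lemma B_nested: "\<exists>F' Y. nested F' Y \<and> F' \<noteq> {} \<and> B = nested_ball F' Y"
proof -
  define E where "E = {v \<in> F. G v \<notin> B}"
  let ?F = "F - E" and ?Y = "\<lambda>v. X v \<union> E"
  have "principal B = (\<lambda>v. ?F - {v} \<union> ?Y v) ` ?F"
  proof (intro equalityI subsetI)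
    fix P assume P: "P \<in> principal B"
    then have "P \<in> principal S"
      using dec unfolding nh_decomposition_def top_generated_def by blast
    moreover have "P \<noteq> F"
      using P nh_decomposition_top_simplex(2)[OF dec F(1,3)] by (auto simp: principal_def)
    ultimately obtain v where v: "v \<in> F" "P = G v"
      unfolding prin by blast
    then have "v \<in> ?F"
      using P unfolding E_def principal_def by simp
    moreover from this have "P = ?F - {v} \<union> ?Y v"
      unfolding v(2) E_def by auto
    ultimately show "P \<in> (\<lambda>v. ?F - {v} \<union> ?Y v) ` ?F"
      by blast
  next
    fix P assume "P \<in> (\<lambda>v. ?F - {v} \<union> ?Y v) ` ?F"
    then obtain v where v: "v \<in> ?F" "P = ?F - {v} \<union> ?Y v"
      by blast
    then have "P = G v"
      unfolding E_def by auto
    then show "P \<in> principal B"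
      using v(1) facet_in(1)[of v] complexes(4) unfolding E_def principal_def by auto
  qed
  then have "B = nested_ball ?F ?Y"
    unfolding nested_ball_def using Union_Pow_principal[OF complexes(2)] by simp
  moreover have "nested ?F ?Y"
    unfolding nested_def
  proof (intro conjI ballI)
    show "finite ?F"
      using F(2) by simp
  next
    fix v assume v: "v \<in> ?F"
    then have "v \<in> F" by blast
    show "finite (?Y v)"
      using X(2)[OF \<open>v \<in> F\<close>] F(2) by (simp add: E_def)
    show "?Y v \<noteq> {}"
      using X(1)[OF \<open>v \<in> F\<close>] by blast
    show "?Y v \<inter> ?F = {}"
      using X(3)[OF \<open>v \<in> F\<close>] by blast
  next
    fix u v assume "u \<in> ?F" "v \<in> ?F"
    then have "X u \<subseteq> X v \<or> X v \<subseteq> X u"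
      using nestedD(5)[OF nested_F_X, of u v] by blast
    then show "?Y u \<subseteq> ?Y v \<or> ?Y v \<subseteq> ?Y u"
      by blast
  qed
  \<comment> \<open>A ball has a dimension, so it is not void and keeps at least one of the exchange
    facets.\<close>
  moreover have "?F \<noteq> {}"
  proof
    assume "?F = {}"
    then have "B = {}"
      using \<open>B = nested_ball ?F ?Y\<close> nested_ball_empty by metis
    moreover have "has_dim B d"
      using dec nh_manifoldD(2)[OF nh_ball_imp_manifold] unfolding nh_decomposition_def by blast
    ultimately show False
      unfolding has_dim_def by blast
  qed
  ultimately show ?thesis
    by blast
qed

end

lemma nested_sphere_and_ball:
  "(\<exists>F X. nested F X \<and> S = nested_sphere F X) \<and> (\<exists>F X. nested F X \<and> F \<noteq> {} \<and> B = nested_ball F X)"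
proof -
  obtain F X where F: "F \<in> L" "finite F" "card F = Suc k"
    and X: "\<forall>v\<in>F. X v \<noteq> {} \<and> finite (X v) \<and> X v \<inter> F = {}"
    and prin: "principal S = insert F ((\<lambda>v. F - {v} \<union> X v) ` F)"
    using ex_facets by blast
  have X': "\<And>v. v \<in> F \<Longrightarrow> X v \<noteq> {}" "\<And>v. v \<in> F \<Longrightarrow> finite (X v)" "\<And>v. v \<in> F \<Longrightarrow> X v \<inter> F = {}"
    using X by auto
  have "nested F X" "S = nested_sphere F X"
    using nested_F_X[OF F X' prin] S_eq_nested_sphere[OF F X' prin] by auto
  moreover have "\<exists>F X. nested F X \<and> F \<noteq> {} \<and> B = nested_ball F X"
    using B_nested[OF F X' prin] by simp
  ultimately show ?thesis
    by blast
qed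

end

lemma nested_if_minimal_nh_sphere:
  assumes "minimal_nh_sphere S"
  shows "\<exists>F X. nested F X \<and> S = nested_sphere F X"
proof -
  obtain d k where nh: "nh_sphere d k S" and min: "int (num_principal S) = k + 2"
    using assms unfolding minimal_nh_sphere_def by blast
  from nh show ?thesis
  proof (cases rule: nh_sphere.cases)
    case sphere_minus_1
    then show ?thesis
      using nested_sphere_empty by (intro exI[of _ "{}"]) (auto simp: nested_def)
  next
    case (sphere_0 v w)
    then have "nested {v} (\<lambda>_. {w})" "S = nested_sphere {v} (\<lambda>_. {w})"
      by (auto simp: nested_def nested_sphere_def nested_ball_def)
    then show ?thesis
      by blast
  next
    case (sphere d' B k' L)
    then have "minimal_nh_decomposition d' k' S B L"
      using min unfolding minimal_nh_decomposition_def nh_decomposition_def by auto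
    then show ?thesis
      using minimal_nh_decomposition.nested_sphere_and_ball by blast
  qed
qed

lemma nested_if_minimal_nh_ball:
  fixes B :: "'a::infinite set set"
  assumes "minimal_nh_ball B"
  shows "\<exists>F X. nested F X \<and> F \<noteq> {} \<and> B = nested_ball F X"
proof -
  obtain S L d k where nh: "nh_sphere (int d) (int k) S" and min: "int (num_principal S) = int k + 2"
    and dec: "nh_decomposition d k S B L"
    using assms unfolding minimal_nh_ball_def by blast
  show ?thesis
  proof (cases "d = 0")
    case True
    have "nh_ball 0 B"
      using dec True unfolding nh_decomposition_def by simp
    then obtain v where B: "B = {{}, {v}}"
      by (auto elim: nh_ball.cases)
    \<comment> \<open>A one-point ball is a simplex and needs a fresh index.\<close>
    obtain w where "w \<notin> {v}"
      using ex_new_if_finite[OF infinite_UNIV, of "{v}"] by blast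
    then have "nested {w} (\<lambda>_. {v})" "B = nested_ball {w} (\<lambda>_. {v})"
      unfolding B by (auto simp: nested_def nested_ball_def)
    then show ?thesis
      by blast
  next
    case False
    have "nh_manifold d S"
      using nh False by (auto elim: nh_sphere.cases)
    then have "minimal_nh_decomposition d k S B L"
      using min dec False unfolding minimal_nh_decomposition_def by auto
    then show ?thesis
      using minimal_nh_decomposition.nested_sphere_and_ball by blast
  qed
qed

theorem theorem1p1:
  fixes K :: "'a::infinite set set"
  assumes "fin_complex K"
  shows "((\<exists>m d. is_simplex_boundary d (iterated_dual m K)) \<longleftrightarrow> minimal_nh_sphere K) \<and>
         ((\<exists>m d. is_simplex d (iterated_dual m K)) \<longleftrightarrow> minimal_nh_ball K)"
proof (intro conjI iffI)
  assume "\<exists>m d. is_simplex_boundary d (iterated_dual m K)"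
  then show "minimal_nh_sphere K"
    using nested_sphere_if_iterated_dual[OF assms] minimal_nh_sphere_nested by metis
next
  assume "minimal_nh_sphere K"
  then show "\<exists>m d. is_simplex_boundary d (iterated_dual m K)"
    using nested_if_minimal_nh_sphere iterated_dual_nested_sphere by metis
next
  assume "\<exists>m d. is_simplex d (iterated_dual m K)"
  then show "minimal_nh_ball K"
    using nested_ball_if_iterated_dual[OF assms] minimal_nh_ball_nested by metis
next
  assume "minimal_nh_ball K"
  then show "\<exists>m d. is_simplex d (iterated_dual m K)"
    using nested_if_minimal_nh_ball iterated_dual_nested_ball by metis
qed

end
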